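(* Let $(u_h,q_h,p_h,w_h,r_h,v_h)\in[W_h^k]^6$ (depending on time $t$) together with penalty parameters $\tau_{pu},\tau_{pv}\in\mathbb R$ (constant in space, possibly depending on $t$) satisfy the HS--KdV DG equations given in the context with the numerical traces $$\widehat u_h=\{u_h\},\quad \widehat q_h=\{q_h\},\quad \widehat p_h=\{p_h\}+\tau_{pu}[\![u_h]\!]+\tau_{pv}[\![v_h]\!],\quad \widehat v_h=\{v_h\},\quad \widehat w_h=\{w_h\},\quad \widehat r_h=\{r_h\},\quad \widetilde{v_h^2}=\{\Pi v_h^2\},$$ and the two constraints $$\sum_{i=1}^N\Big[a\tau_{pu}[\![u_h]\!]^2+a\tau_{pv}[\![u_h]\!][\![v_h]\!]-a[\![V(u_h)]\!]+a[\![u_h]\!]\{\Pi f(u_h)\}-b\,\Theta(u_h,v_h,v_h)\Big](x_i)=0,$$ $$\begin{aligned} \sum_{i=1}^N\Big[&\big(a[\![p_h]\!]+b[\![\Pi v_h^2]\!]\big)\big(a\tau_{pu}[\![u_h]\!]+a\tau_{pv}[\![v_h]\!]\big)+a[\![p_h]\!]\big(\tau_{pu}[\![u_h]\!]+\tau_{pv}[\![v_h]\!]\big)\\ &+2b\,\Theta(q_h,w_h,v_h)-2b\,\Theta(r_h,u_h,v_h)-2b\,\Theta(u_h,w_h,w_h)-b\,\Theta(p_h,v_h,v_h)\Big](x_i)\\ &+6b\Big(\big(u_h^2,\Pi(w_hv_h)\big)-\big(u_hw_h,\Pi(u_hv_h)\big)\Big)=0, \end{aligned}$$ where $f(u)=3u^2$,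 $V$ is an antiderivative of $f$, and $$\Theta(\phi_1,\phi_2,\phi_3)=[\![\phi_1]\!]\{\phi_2\phi_3\}+[\![\phi_2\phi_3]\!]\{\phi_1\}-\Big([\![\phi_1]\!]\{\Pi(\phi_2\phi_3)\}+[\![\phi_2]\!]\{\Pi(\phi_1\phi_3)\}+[\![\phi_3]\!]\{\Pi(\phi_1\phi_2)\}\Big).$$ Then mass, $L^2$ energy and Hamiltonian are conserved: $$\frac{d}{dt}\int_{\mathcal T_h}u_h\,dx=0,\qquad \frac{d}{dt}\int_{\mathcal T_h}\Big(u_h^2+\frac23 b\,v_h^2\Big)dx=0,$$ $$\frac{d}{dt}\int_{\mathcal T_h}\Big((1+a)\big(u_h^3-\tfrac12 q_h^2\big)+b\big(u_hv_h^2-w_h^2\big)\Big)dx=0 .$$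
   Context: Setting: $a,b$ are real constants and $\Omega=[x_L,x_R]$ is partitioned by nodes $x_L=x_0<x_1<\dots<x_N=x_R$ into elements $I_i=(x_{i-1},x_i)$, $\mathcal T_h=\{I_1,\dots,I_N\}$. Periodic boundary conditions are used: the node $x_0$ is identified with $x_N$, so $\phi(x_0^-):=\phi(x_N^-)$ and $\phi(x_N^+):=\phi(x_0^+)$. For an integer $k\ge 0$, $W_h^k$ is the (periodic) space of functions whose restriction to each $I_i$ is a polynomial of degree at most $k$ (no continuity between elements), and $\Pi$ is the $L^2(\Omega)$-orthogonal projection onto $W_h^k$. Notation: $\int_{\mathcal T_h}\phi\,dx=\sum_i\int_{I_i}\phi\,dx$; $(\phi,v)=\sum_{i=1}^N\int_{I_i}\phi v\,dx$; $\langle\phi,vn\rangle=\sum_{i=1}^N\big(\phi(x_i^-)v(x_i^-)-\phi(x_{i-1}^+)v(x_{i-1}^+)\big)$ (outward normal $n(x_i^-)=1$, $n(x_{i-1}^+)=-1$); a quantity defined at the nodes takes the same value at $x_i^-$ and $x_i^+$. Average and jump at a node: $\{\phi\}(x_i)=\frac12(\phi(x_i^-)+\phi(x_i^+))$, $[\![\phi]\!](x_i)=\phi(x_i^-)-\phi(x_i^+)$. Spatial derivatives are taken elementwise; subscript $t$ denotes the time derivative. All quantities are assumed as differentiable in $t$ as needed. HS--KdV DG equations (a semi-discretization of $u_t=a(u_{xxx}+6uu_x)+2bvv_x$, $v_t=-v_{xxx}-3uv_x$): for all times and all $\alpha,\beta,\gamma,\xi,\psi,\phi\in W_h^k$, $$\begin{aligned}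 (q_h,\alpha)+(u_h,\alpha_x)-\langle\widehat u_h,\alpha n\rangle&=0,\\ (p_h,\beta)+(q_h,\beta_x)-\langle\widehat q_h,\beta n\rangle-(3u_h^2,\beta)&=0,\\ (u_{ht},\gamma)+(ap_h+bv_h^2,\gamma_x)-\langle a\widehat p_h+b\widetilde{v_h^2},\gamma n\rangle&=0,\\ (w_h,\xi)+(v_h,\xi_x)-\langle\widehat v_h,\xi n\rangle&=0,\\ (r_h,\psi)+(w_h,\psi_x)-\langle\widehat w_h,\psi n\rangle&=0,\\ (v_{ht},\phi)-(r_h,\phi_x)+\langle\widehat r_h,\phi n\rangle+(3u_hw_h,\phi)&=0. \end{aligned}$$ *)

theory Defs
  imports "HOL-Analysis.Analysis" "HOL-Computational_Algebra.Polynomial"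
begin

text \<open>
  A mesh is given by its number of elements \<open>N\<close> and its nodes \<open>X 0 < \<dots> < X N\<close>; element \<open>i\<close>
  (for \<open>1 \<le> i \<le> N\<close>) is the open interval between \<open>X (i - 1)\<close> and \<open>X i\<close>. Functions on the mesh are
  functions on the reals of which only the values inside the elements matter: nothing below
  depends on their values at the nodes or outside the mesh.
\<close>

definition is_partition :: "real \<Rightarrow> real \<Rightarrow> nat \<Rightarrow> (nat \<Rightarrow> real) \<Rightarrow> bool" where
  "is_partition xL xR N X \<longleftrightarrow> N \<ge> 1 \<and> X 0 = xL \<and> X N = xR \<and> (\<forall>i<N. X i < X (Suc i))"

definition elem :: "(nat \<Rightarrow> real) \<Rightarrow> nat \<Rightarrow> real set" where
  "elem X i = {X (i - 1)<..<X i}"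

definition dg_space :: "nat \<Rightarrow> (nat \<Rightarrow> real) \<Rightarrow> nat \<Rightarrow> (real \<Rightarrow> real) set" where
  "dg_space N X k =
     {\<phi>. \<forall>i\<in>{1..N}. \<exists>P :: real poly. degree P \<le> k \<and> (\<forall>x\<in>elem X i. \<phi> x = poly P x)}"

definition mesh_integral :: "nat \<Rightarrow> (nat \<Rightarrow> real) \<Rightarrow> (real \<Rightarrow> real) \<Rightarrow> real" where
  "mesh_integral N X \<phi> = (\<Sum>i=1..N. integral (elem X i) \<phi>)"

definition mesh_inner :: "nat \<Rightarrow> (nat \<Rightarrow> real) \<Rightarrow> (real \<Rightarrow> real) \<Rightarrow> (real \<Rightarrow> real) \<Rightarrow> real" where
  "mesh_inner N X \<phi> v = mesh_integral N X (\<lambda>x. \<phi> x * v x)"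

text \<open>
  The one-sided values at the nodes are one-sided limits, with the periodic convention that node
  \<open>0\<close> takes its left value from node \<open>N\<close>, and node \<open>N\<close> its right value from node \<open>0\<close>.
\<close>

definition trace_minus :: "nat \<Rightarrow> (nat \<Rightarrow> real) \<Rightarrow> (real \<Rightarrow> real) \<Rightarrow> nat \<Rightarrow> real" where
  "trace_minus N X \<phi> i = Lim (at_left (if i = 0 then X N else X i)) \<phi>"

definition trace_plus :: "nat \<Rightarrow> (nat \<Rightarrow> real) \<Rightarrow> (real \<Rightarrow> real) \<Rightarrow> nat \<Rightarrow> real" where
  "trace_plus N X \<phi> i = Lim (at_right (if i = N then X 0 else X i)) \<phi>"

definition avg :: "nat \<Rightarrow> (nat \<Rightarrow> real) \<Rightarrow> (real \<Rightarrow> real) \<Rightarrow> nat \<Rightarrow> real" where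
  "avg N X \<phi> i = (trace_minus N X \<phi> i + trace_plus N X \<phi> i) / 2"

definition jump :: "nat \<Rightarrow> (nat \<Rightarrow> real) \<Rightarrow> (real \<Rightarrow> real) \<Rightarrow> nat \<Rightarrow> real" where
  "jump N X \<phi> i = trace_minus N X \<phi> i - trace_plus N X \<phi> i"

text \<open>
  The form \<open>\<langle>g, v n\<rangle>\<close> for a quantity \<open>g\<close> defined at the nodes (a numerical trace), which takes the
  value \<open>g i\<close> on both sides of node \<open>i\<close>.
\<close>

definition bdry :: "nat \<Rightarrow> (nat \<Rightarrow> real) \<Rightarrow> (nat \<Rightarrow> real) \<Rightarrow> (real \<Rightarrow> real) \<Rightarrow> real" where
  "bdry N X g v =
     (\<Sum>i=1..N. g i * trace_minus N X v i - g (i - 1) * trace_plus N X v (i - 1))"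

text \<open>
  The orthogonal projection is unique only as a function on the elements; the choice
  operator fixes the irrelevant values elsewhere.
\<close>

definition proj :: "nat \<Rightarrow> (nat \<Rightarrow> real) \<Rightarrow> nat \<Rightarrow> (real \<Rightarrow> real) \<Rightarrow> real \<Rightarrow> real" where
  "proj N X k g =
     (SOME \<phi>. \<phi> \<in> dg_space N X k \<and>
        (\<forall>v\<in>dg_space N X k. mesh_inner N X (\<lambda>x. g x - \<phi> x) v = 0))"

definition Theta :: "nat \<Rightarrow> (nat \<Rightarrow> real) \<Rightarrow> nat \<Rightarrow>
    (real \<Rightarrow> real) \<Rightarrow> (real \<Rightarrow> real) \<Rightarrow> (real \<Rightarrow> real) \<Rightarrow> nat \<Rightarrow> real" where
  "Theta N X k \<phi>1 \<phi>2 \<phi>3 i =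
     jump N X \<phi>1 i * avg N X (\<lambda>x. \<phi>2 x * \<phi>3 x) i
     + jump N X (\<lambda>x. \<phi>2 x * \<phi>3 x) i * avg N X \<phi>1 i
     - (jump N X \<phi>1 i * avg N X (proj N X k (\<lambda>x. \<phi>2 x * \<phi>3 x)) i
        + jump N X \<phi>2 i * avg N X (proj N X k (\<lambda>x. \<phi>1 x * \<phi>3 x)) i
        + jump N X \<phi>3 i * avg N X (proj N X k (\<lambda>x. \<phi>1 x * \<phi>2 x)) i)"

text \<open>
  Functions of time and space have type \<open>real \<Rightarrow> real \<Rightarrow> real\<close>, time first. Time ranges over an
  interval \<open>J\<close>; derivatives at an endpoint belonging to \<open>J\<close> are one-sided.
\<close>

definition time_differentiable ::
    "nat \<Rightarrow> (nat \<Rightarrow> real) \<Rightarrow> real set \<Rightarrow> (real \<Rightarrow> real \<Rightarrow> real) \<Rightarrow> bool" where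
  "time_differentiable N X J \<phi> \<longleftrightarrow>
     (\<forall>t\<in>J. \<forall>i\<in>{1..N}. \<forall>x\<in>elem X i. (\<lambda>s. \<phi> s x) differentiable (at t within J))"

definition time_deriv :: "real set \<Rightarrow> (real \<Rightarrow> real \<Rightarrow> real) \<Rightarrow> real \<Rightarrow> real \<Rightarrow> real" where
  "time_deriv J \<phi> t x = vector_derivative (\<lambda>s. \<phi> s x) (at t within J)"

text \<open>
  The DG equations at one instant. The arguments \<open>ut\<close>, \<open>vt\<close> stand for the time derivatives of
  \<open>u\<close>, \<open>v\<close>, and the arguments \<open>uh\<close>, \<open>qh\<close>, \<open>ph\<close>, \<open>vh\<close>, \<open>wh\<close>, \<open>rh\<close>, \<open>vsq\<close> for the numerical traces of
  \<open>u\<close>, \<open>q\<close>, \<open>p\<close>, \<open>v\<close>, \<open>w\<close>, \<open>r\<close> and of the square of \<open>v\<close>. Inside an element, \<open>deriv\<close> is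
  the elementwise spatial derivative.
\<close>

definition hs_kdv_dg :: "nat \<Rightarrow> (nat \<Rightarrow> real) \<Rightarrow> nat \<Rightarrow> real \<Rightarrow> real \<Rightarrow>
    (real \<Rightarrow> real) \<Rightarrow> (real \<Rightarrow> real) \<Rightarrow> (real \<Rightarrow> real) \<Rightarrow>
    (real \<Rightarrow> real) \<Rightarrow> (real \<Rightarrow> real) \<Rightarrow> (real \<Rightarrow> real) \<Rightarrow>
    (real \<Rightarrow> real) \<Rightarrow> (real \<Rightarrow> real) \<Rightarrow>
    (nat \<Rightarrow> real) \<Rightarrow> (nat \<Rightarrow> real) \<Rightarrow> (nat \<Rightarrow> real) \<Rightarrow>
    (nat \<Rightarrow> real) \<Rightarrow> (nat \<Rightarrow> real) \<Rightarrow> (nat \<Rightarrow> real) \<Rightarrow> (nat \<Rightarrow> real) \<Rightarrow> bool" where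
  "hs_kdv_dg N X k a b u q p w r v ut vt uh qh ph vh wh rh vsq \<longleftrightarrow>
     (\<forall>\<alpha>\<in>dg_space N X k.
        mesh_inner N X q \<alpha> + mesh_inner N X u (deriv \<alpha>) - bdry N X uh \<alpha> = 0) \<and>
     (\<forall>\<beta>\<in>dg_space N X k.
        mesh_inner N X p \<beta> + mesh_inner N X q (deriv \<beta>) - bdry N X qh \<beta>
        - mesh_inner N X (\<lambda>x. 3 * (u x)^2) \<beta> = 0) \<and>
     (\<forall>\<gamma>\<in>dg_space N X k.
        mesh_inner N X ut \<gamma> + mesh_inner N X (\<lambda>x. a * p x + b * (v x)^2) (deriv \<gamma>)
        - bdry N X (\<lambda>i. a * ph i + b * vsq i) \<gamma> = 0) \<and>
     (\<forall>\<xi>\<in>dg_space N X k.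
        mesh_inner N X w \<xi> + mesh_inner N X v (deriv \<xi>) - bdry N X vh \<xi> = 0) \<and>
     (\<forall>\<psi>\<in>dg_space N X k.
        mesh_inner N X r \<psi> + mesh_inner N X w (deriv \<psi>) - bdry N X wh \<psi> = 0) \<and>
     (\<forall>\<phi>\<in>dg_space N X k.
        mesh_inner N X vt \<phi> - mesh_inner N X r (deriv \<phi>) + bdry N X rh \<phi>
        + mesh_inner N X (\<lambda>x. 3 * u x * w x) \<phi> = 0)"

end

theory Submission
  imports Defs
begin

text \<open>
  Everything reduces to the form \<open>D(\<phi>, \<psi>) = (\<phi>\<^sub>x, \<psi>) - \<Sum> [\<phi>]{\<psi>}\<close>, the weak derivative with
  averaged traces, which is antisymmetric by periodic summation by parts. Tested with functions of
  the discrete space, the scheme says \<open>(q, \<cdot>) = D(u, \<cdot>)\<close>, \<open>(p, \<cdot>) = D(q, \<cdot>) + (3u\<^sup>2, \<cdot>)\<close>,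
  \<open>(w, \<cdot>) = D(v, \<cdot>)\<close>, \<open>(r, \<cdot>) = D(w, \<cdot>)\<close>, \<open>(v\<^sub>t, \<cdot>) = - D(r, \<cdot>) - (3uw, \<cdot>)\<close>, and
  \<open>(u\<^sub>t, \<cdot>) = D(ap + b\<Pi>v\<^sup>2, \<cdot>)\<close> up to the penalty. Since \<open>\<phi>\<^sub>x\<close> lies in the discrete space,
  \<open>\<Sum> \<Theta>(\<phi>\<^sub>1, \<phi>\<^sub>2, \<phi>\<^sub>3) = D(\<phi>\<^sub>1, \<Pi>(\<phi>\<^sub>2\<phi>\<^sub>3)) + D(\<phi>\<^sub>2, \<Pi>(\<phi>\<^sub>1\<phi>\<^sub>3)) + D(\<phi>\<^sub>3, \<Pi>(\<phi>\<^sub>1\<phi>\<^sub>2))\<close>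
  and \<open>\<Sum> ([V(u)] - [u]{\<Pi>f(u)}) = D(u, \<Pi>f(u))\<close>. With these the time derivatives of energy and
  Hamiltonian become, by bilinear algebra alone, the left-hand sides of the two constraints (up to
  a factor 2 for the energy); for the Hamiltonian, the equations for \<open>q\<close> and \<open>w\<close> are first
  differentiated in time.
\<close>

subsection \<open>Polynomials on an interval\<close>

lemma continuous_on_poly_real: "continuous_on S (poly (P :: real poly))"
  by (intro continuous_intros)

lemma poly_integrable_Ioo: "poly (P :: real poly) integrable_on {c<..<d}"
  unfolding integrable_on_open_interval_real
  by (intro integrable_continuous_real continuous_on_poly_real)

section \<open>Orthogonal projection of polynomials on one interval\<close>

lemma poly_eq_0_if_integral_square_eq_0:
  fixes P :: "real poly"
  assumes "c < d" and "integral {c<..<d} (poly (P * P)) = 0"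
  shows "P = 0"
proof (rule ccontr)
  assume "P \<noteq> 0"
  have "\<forall>x\<in>{c..d}. poly (P * P) x = 0"
    using assms by (subst integral_eq_0_iff [symmetric])
      (auto simp: integral_open_interval_real continuous_on_poly_real intro: continuous_on_mult)
  then have "{c<..<d} \<subseteq> {x. poly P x = 0}"
    by auto
  with poly_roots_finite [OF \<open>P \<noteq> 0\<close>] have "finite {c<..<d}"
    by (rule finite_subset[rotated])
  with infinite_Ioo [OF \<open>c < d\<close>] show False
    by simp
qed

text \<open>Gram-Schmidt by induction on the dimension \<open>n\<close>. The bound on the degree is
  phrased through vanishing coefficients so that \<open>n = 0\<close> describes the zero space,
  which a bound on \<open>degree\<close> cannot do. The induction hypothesis is used for two
  polynomials, hence the generalization over \<open>G\<close>.\<close>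

lemma poly_projection_exists:
  fixes G :: "real poly"
  assumes "c < d"
  shows "\<exists>P. (\<forall>j\<ge>n. coeff P j = 0) \<and>
    (\<forall>Q. (\<forall>j\<ge>n. coeff Q j = 0) \<longrightarrow> integral {c<..<d} (poly ((G - P) * Q)) = 0)"
proof (induction n arbitrary: G)
  case 0
  have "integral {c<..<d} (poly (G * Q)) = 0" if "\<forall>j\<ge>0. coeff Q j = 0" for Q
  proof -
    have "Q = 0"
      using that by (simp add: poly_eq_iff)
    then show ?thesis
      by (simp add: poly_0 [abs_def])
  qed
  then show ?case
    by (intro exI [of _ 0]) (simp del: poly_mult)
next
  case (Suc n)
  define I where "I P = integral {c<..<d} (poly P)" for P :: "real poly"
  have I_add: "I (P + Q) = I P + I Q" for P Q
    unfolding I_def using integral_add [OF poly_integrable_Ioo [of P] poly_integrable_Ioo [of Q]]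
    by (simp add: poly_add [abs_def])
  have I_smult: "I (smult r P) = r * I P" for r P
    unfolding I_def by (simp add: poly_smult [abs_def])
  have I_diff: "I (P - Q) = I P - I Q" for P Q
    using I_add [of P "smult (-1) Q"] I_smult [of "-1" Q] by simp
  from Suc obtain R where R: "\<forall>j\<ge>n. coeff R j = 0"
    and R_orth: "\<And>Q. \<forall>j\<ge>n. coeff Q j = 0 \<Longrightarrow> I ((monom 1 n - R) * Q) = 0"
    unfolding I_def by blast
  \<comment> \<open>\<open>E\<close> is the monic orthogonal polynomial of degree \<open>n\<close>:
    the monomial minus its projection onto lower degrees.\<close>
  define E where "E = monom 1 n - R"
  from Suc obtain P where P: "\<forall>j\<ge>n. coeff P j = 0"
    and P_orth: "\<And>Q. \<forall>j\<ge>n. coeff Q j = 0 \<Longrightarrow> I ((G - P) * Q) = 0"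
    unfolding I_def by blast
  have E_n: "coeff E n = 1" and E_gt: "\<forall>j\<ge>Suc n. coeff E j = 0"
    using R by (auto simp: E_def)
  then have "I (E * E) \<noteq> 0"
    using poly_eq_0_if_integral_square_eq_0 [OF \<open>c < d\<close>, of E] by (auto simp: I_def)
  define e where "e = I (G * E) / I (E * E)"
  define P' where "P' = P + smult e E"
  have E_orth: "I (E * Q) = 0" if "\<forall>j\<ge>n. coeff Q j = 0" for Q
    using R_orth that by (simp add: E_def)
  have orth: "I ((G - P') * Q) = 0" if Q: "\<forall>j\<ge>Suc n. coeff Q j = 0" for Q
  proof -
    \<comment> \<open>Subtracting the right multiple of \<open>E\<close> removes the leading term of
      \<open>Q\<close>, so that \<open>S\<close> falls under the induction hypothesis.\<close>
    define S where "S = Q - smult (coeff Q n) E"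
    have S: "\<forall>j\<ge>n. coeff S j = 0"
    proof clarify
      fix j assume "n \<le> j"
      then consider "j = n" | "Suc n \<le> j"
        by linarith
      then show "coeff S j = 0"
        using Q E_gt E_n by cases (simp_all add: S_def)
    qed
    \<comment> \<open>The first term vanishes by the choice of \<open>P\<close>, the products of
      \<open>E\<close> with \<open>S\<close> and \<open>P\<close> by orthogonality; the terms with
      \<open>G * E\<close> and \<open>E * E\<close> cancel by the choice of
      \<open>e\<close>.\<close>
    have "(G - P') * Q = (G - P) * S - smult e (E * S) + smult (coeff Q n) (G * E)
        - smult (coeff Q n) (E * P) - smult (coeff Q n * e) (E * E)"
      by (simp add: S_def P'_def algebra_simps smult_diff_right smult_add_right)
    then have "I ((G - P') * Q) = I ((G - P) * S) - e * I (E * S) + coeff Q n * I (G * E)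
        - coeff Q n * I (E * P) - coeff Q n * e * I (E * E)"
      by (simp only: I_add I_diff I_smult)
    also have "\<dots> = 0"
      using P_orth [OF S] E_orth [OF S] E_orth [OF P] \<open>I (E * E) \<noteq> 0\<close> by (simp add: e_def)
    finally show ?thesis .
  qed
  have "\<forall>j\<ge>Suc n. coeff P' j = 0"
    using P E_gt by (simp add: P'_def)
  with orth show ?case
    unfolding I_def by blast
qed

text \<open>Two polynomials of degree at most \<open>k\<close> that agree at \<open>k + 1\<close>
  points are equal. The point values thus serve as coordinates, which later carries pointwise
  differentiability in time over to integrals and traces.\<close>

lemma Lagrange_basis_exists:
  fixes A :: "real set"
  assumes "finite A" and "card A = Suc k"
  shows "\<exists>L. (\<forall>y\<in>A. degree (L y) \<le> k) \<and>
    (\<forall>P. degree P \<le> k \<longrightarrow> P = (\<Sum>y\<in>A. smult (poly P y) (L y)))"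
proof -
  define L where "L y = (\<Prod>z\<in>A - {y}. smult (1 / (y - z)) [:- z, 1:])" for y
  have deg: "degree (L y) \<le> k" if "y \<in> A" for y
  proof -
    have "degree (L y) \<le> sum (degree \<circ> (\<lambda>z. smult (1 / (y - z)) [:- z, 1:])) (A - {y})"
      unfolding L_def using \<open>finite A\<close> by (intro degree_prod_sum_le) simp
    also have "\<dots> \<le> (\<Sum>z\<in>A - {y}. 1)"
      by (intro sum_mono) simp
    also have "\<dots> = k"
      using assms that by simp
    finally show ?thesis .
  qed
  have eval: "poly (L y) x = (if x = y then 1 else 0)" if "x \<in> A" "y \<in> A" for x y
  proof (cases "x = y")
    case True
    then show ?thesis
      by (simp add: L_def poly_prod prod.neutral flip: diff_divide_distrib)
  next
    case False
    then have "\<exists>z\<in>A - {y}. poly (smult (1 / (y - z)) [:- z, 1:]) x = 0"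
      using \<open>x \<in> A\<close> by (intro bexI [of _ x]) auto
    then have "poly (L y) x = 0"
      unfolding L_def poly_prod using \<open>finite A\<close> by (intro prod_zero) auto
    with False show ?thesis
      by simp
  qed
  have "P = (\<Sum>y\<in>A. smult (poly P y) (L y))" if P: "degree P \<le> k" for P
  proof (rule poly_eqI_degree [of A])
    fix x assume "x \<in> A"
    have "poly (\<Sum>y\<in>A. smult (poly P y) (L y)) x = (\<Sum>y\<in>A. if x = y then poly P y else 0)"
      unfolding poly_sum by (intro sum.cong) (simp_all add: eval \<open>x \<in> A\<close>)
    then show "poly P x = poly (\<Sum>y\<in>A. smult (poly P y) (L y)) x"
      using \<open>finite A\<close> \<open>x \<in> A\<close> by simp
  next
    show "degree P < card A"
      using assms P by simp
    have "degree (\<Sum>y\<in>A. smult (poly P y) (L y)) \<le> k"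
      using deg by (intro degree_sum_le \<open>finite A\<close>) (simp add: degree_smult_le [THEN order_trans])
    then show "degree (\<Sum>y\<in>A. smult (poly P y) (L y)) < card A"
      using assms by simp
  qed
  with deg show ?thesis
    by (intro exI [of _ L]) simp
qed

subsection \<open>Piecewise polynomials on a mesh\<close>

lemma dg_space_cmult: "\<phi> \<in> dg_space N X k \<Longrightarrow> (\<lambda>x. c * \<phi> x) \<in> dg_space N X k"
  unfolding dg_space_def
  by (clarsimp, drule bspec, simp, elim exE conjE,
      rule_tac x = "smult c P" in exI, auto intro: degree_smult_le [THEN order_trans])

lemma dg_space_add:
  assumes "\<phi> \<in> dg_space N X k" "\<psi> \<in> dg_space N X k"
  shows "(\<lambda>x. \<phi> x + \<psi> x) \<in> dg_space N X k"
  unfolding dg_space_def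
proof clarify
  fix i assume "i \<in> {1..N}"
  with assms obtain P Q where "degree P \<le> k" "degree Q \<le> k"
      "\<forall>x\<in>elem X i. \<phi> x = poly P x" "\<forall>x\<in>elem X i. \<psi> x = poly Q x"
    unfolding dg_space_def by blast
  then show "\<exists>P. degree P \<le> k \<and> (\<forall>x\<in>elem X i. \<phi> x + \<psi> x = poly P x)"
    by (intro exI [of _ "P + Q"]) (auto intro: degree_add_le)
qed

lemma dg_space_diff:
  assumes "\<phi> \<in> dg_space N X k" "\<psi> \<in> dg_space N X k"
  shows "(\<lambda>x. \<phi> x - \<psi> x) \<in> dg_space N X k"
  using dg_space_add [OF assms(1) dg_space_cmult [OF assms(2), of "-1"]] by simp

lemma dg_space_mult:
  assumes "\<phi> \<in> dg_space N X k" "\<psi> \<in> dg_space N X m"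
  shows "(\<lambda>x. \<phi> x * \<psi> x) \<in> dg_space N X (k + m)"
  unfolding dg_space_def
proof clarify
  fix i assume "i \<in> {1..N}"
  with assms obtain P Q where "degree P \<le> k" "degree Q \<le> m"
      "\<forall>x\<in>elem X i. \<phi> x = poly P x" "\<forall>x\<in>elem X i. \<psi> x = poly Q x"
    unfolding dg_space_def by blast
  then show "\<exists>P. degree P \<le> k + m \<and> (\<forall>x\<in>elem X i. \<phi> x * \<psi> x = poly P x)"
    by (intro exI [of _ "P * Q"]) (auto intro: degree_mult_le [THEN order_trans])
qed

lemma dg_space_mono: "\<phi> \<in> dg_space N X k \<Longrightarrow> k \<le> m \<Longrightarrow> \<phi> \<in> dg_space N X m"
  unfolding dg_space_def using order_trans by blast

lemma dg_space_const: "(\<lambda>x. c) \<in> dg_space N X k"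
  unfolding dg_space_def by (auto intro!: exI [of _ "[:c:]"])

text \<open>The element is open, so near each of its points the function coincides with the
  polynomial, whatever its values elsewhere.\<close>

lemma deriv_on_elem:
  assumes "\<forall>y\<in>elem X i. \<phi> y = poly P y" and x: "x \<in> elem X i"
  shows "deriv \<phi> x = poly (pderiv P) x"
proof (rule DERIV_imp_deriv)
  have "open (elem X i)"
    by (simp add: elem_def)
  then have "\<forall>\<^sub>F y in nhds x. \<phi> y = poly P y"
    using eventually_nhds_in_open [of "elem X i" x] x assms(1) by (simp add: eventually_mono)
  then show "(\<phi> has_real_derivative poly (pderiv P) x) (at x)"
    using DERIV_cong_ev [OF refl _ refl] poly_DERIV [of P x] by blast
qed

lemma dg_space_deriv:
  assumes "\<phi> \<in> dg_space N X k"
  shows "deriv \<phi> \<in> dg_space N X k"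
  unfolding dg_space_def
proof clarify
  fix i assume "i \<in> {1..N}"
  with assms obtain P where "degree P \<le> k" "\<forall>x\<in>elem X i. \<phi> x = poly P x"
    unfolding dg_space_def by blast
  then show "\<exists>P. degree P \<le> k \<and> (\<forall>x\<in>elem X i. deriv \<phi> x = poly P x)"
    by (intro exI [of _ "pderiv P"]) (simp add: degree_pderiv deriv_on_elem [of X i \<phi> P])
qed

text \<open>Products leave the space of degree \<open>k\<close>. Integration by parts is therefore
  carried out for piecewise polynomials of arbitrary degree, and \<open>k\<close> enters only with
  the projection.\<close>

definition pw_poly :: "nat \<Rightarrow> (nat \<Rightarrow> real) \<Rightarrow> (real \<Rightarrow> real) \<Rightarrow> bool" where
  "pw_poly N X \<phi> \<longleftrightarrow> (\<exists>k. \<phi> \<in> dg_space N X k)"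

named_theorems pw_poly_intros

lemma pw_poly_dg_space: "\<phi> \<in> dg_space N X k \<Longrightarrow> pw_poly N X \<phi>"
  by (auto simp: pw_poly_def)

lemma pw_polyE:
  assumes "pw_poly N X \<phi>" and "i \<in> {1..N}"
  obtains P where "\<forall>x\<in>elem X i. \<phi> x = poly P x"
  using assms unfolding pw_poly_def dg_space_def by blast

lemma pw_poly_const [pw_poly_intros]: "pw_poly N X (\<lambda>x. c)"
  unfolding pw_poly_def using dg_space_const by blast

lemma pw_poly_mult [pw_poly_intros]:
  "pw_poly N X \<phi> \<Longrightarrow> pw_poly N X \<psi> \<Longrightarrow> pw_poly N X (\<lambda>x. \<phi> x * \<psi> x)"
  unfolding pw_poly_def using dg_space_mult by blast

lemma pw_poly_power [pw_poly_intros]: "pw_poly N X \<phi> \<Longrightarrow> pw_poly N X (\<lambda>x. \<phi> x ^ n)"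
  by (induction n) (auto intro: pw_poly_intros)

lemma pw_poly_add [pw_poly_intros]:
  assumes "pw_poly N X \<phi>" "pw_poly N X \<psi>"
  shows "pw_poly N X (\<lambda>x. \<phi> x + \<psi> x)"
proof -
  from assms obtain k m where "\<phi> \<in> dg_space N X k" "\<psi> \<in> dg_space N X m"
    unfolding pw_poly_def by blast
  then have "\<phi> \<in> dg_space N X (k + m)" "\<psi> \<in> dg_space N X (k + m)"
    by (simp_all add: dg_space_mono)
  then show ?thesis
    unfolding pw_poly_def using dg_space_add by blast
qed

lemma pw_poly_diff [pw_poly_intros]:
  assumes "pw_poly N X \<phi>" "pw_poly N X \<psi>"
  shows "pw_poly N X (\<lambda>x. \<phi> x - \<psi> x)"
proof -
  from assms obtain k m where "\<phi> \<in> dg_space N X k" "\<psi> \<in> dg_space N X m"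
    unfolding pw_poly_def by blast
  then have "\<phi> \<in> dg_space N X (k + m)" "\<psi> \<in> dg_space N X (k + m)"
    by (simp_all add: dg_space_mono)
  then show ?thesis
    unfolding pw_poly_def using dg_space_diff by blast
qed

lemma pw_poly_deriv [pw_poly_intros]: "pw_poly N X \<phi> \<Longrightarrow> pw_poly N X (deriv \<phi>)"
  unfolding pw_poly_def using dg_space_deriv by blast

lemma deriv_mult_on_elem:
  assumes "pw_poly N X \<phi>" "pw_poly N X \<psi>" "i \<in> {1..N}" "x \<in> elem X i"
  shows "deriv (\<lambda>x. \<phi> x * \<psi> x) x = deriv \<phi> x * \<psi> x + \<phi> x * deriv \<psi> x"
proof -
  obtain P where P: "\<forall>x\<in>elem X i. \<phi> x = poly P x"
    using assms(1,3) by (rule pw_polyE)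
  obtain Q where Q: "\<forall>x\<in>elem X i. \<psi> x = poly Q x"
    using assms(2,3) by (rule pw_polyE)
  from P Q have "\<forall>x\<in>elem X i. \<phi> x * \<psi> x = poly (P * Q) x"
    by simp
  from deriv_on_elem [OF this \<open>x \<in> elem X i\<close>] deriv_on_elem [OF P \<open>x \<in> elem X i\<close>]
    deriv_on_elem [OF Q \<open>x \<in> elem X i\<close>]
  show ?thesis
    using P Q \<open>x \<in> elem X i\<close> by (simp add: pderiv_mult algebra_simps)
qed

section \<open>Linearity of the integral over the mesh\<close>

lemma integrable_on_elem:
  assumes "pw_poly N X \<phi>" and "i \<in> {1..N}"
  shows "\<phi> integrable_on elem X i"
proof -
  from assms obtain P where "\<forall>x\<in>elem X i. \<phi> x = poly P x"
    by (rule pw_polyE)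
  then show ?thesis
    using integrable_cong [of "elem X i" \<phi> "poly P"] poly_integrable_Ioo [of P] unfolding elem_def by simp
qed

lemma mesh_integral_cong:
  assumes "\<And>i x. i \<in> {1..N} \<Longrightarrow> x \<in> elem X i \<Longrightarrow> \<phi> x = \<psi> x"
  shows "mesh_integral N X \<phi> = mesh_integral N X \<psi>"
  unfolding mesh_integral_def using assms by (intro sum.cong Henstock_Kurzweil_Integration.integral_cong refl) auto

lemma mesh_integral_add:
  assumes "pw_poly N X \<phi>" "pw_poly N X \<psi>"
  shows "mesh_integral N X (\<lambda>x. \<phi> x + \<psi> x) = mesh_integral N X \<phi> + mesh_integral N X \<psi>"
  unfolding mesh_integral_def sum.distrib [symmetric] using integrable_on_elem assms
  by (intro sum.cong refl Henstock_Kurzweil_Integration.integral_add) auto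

lemma mesh_integral_diff:
  assumes "pw_poly N X \<phi>" "pw_poly N X \<psi>"
  shows "mesh_integral N X (\<lambda>x. \<phi> x - \<psi> x) = mesh_integral N X \<phi> - mesh_integral N X \<psi>"
  unfolding mesh_integral_def sum_subtractf [symmetric] using integrable_on_elem assms
  by (intro sum.cong refl Henstock_Kurzweil_Integration.integral_diff) auto

lemma mesh_integral_cmult: "mesh_integral N X (\<lambda>x. c * \<phi> x) = c * mesh_integral N X \<phi>"
  unfolding mesh_integral_def sum_distrib_left by simp

subsection \<open>The weak derivative form\<close>

definition weak_deriv :: "nat \<Rightarrow> (nat \<Rightarrow> real) \<Rightarrow> (real \<Rightarrow> real) \<Rightarrow> (real \<Rightarrow> real) \<Rightarrow> real" where
  "weak_deriv N X \<phi> \<psi> = mesh_inner N X (deriv \<phi>) \<psi> - (\<Sum>i=1..N. jump N X \<phi> i * avg N X \<psi> i)"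

lemma mesh_inner_commute: "mesh_inner N X \<phi> \<psi> = mesh_inner N X \<psi> \<phi>"
  by (simp add: mesh_inner_def mult.commute)

lemma mesh_inner_add_left:
  assumes "pw_poly N X \<phi>1" "pw_poly N X \<phi>2" "pw_poly N X \<psi>"
  shows "mesh_inner N X (\<lambda>x. \<phi>1 x + \<phi>2 x) \<psi> = mesh_inner N X \<phi>1 \<psi> + mesh_inner N X \<phi>2 \<psi>"
  unfolding mesh_inner_def using assms
  by (simp add: distrib_right mesh_integral_add pw_poly_intros)

lemma mesh_inner_diff_left:
  assumes "pw_poly N X \<phi>1" "pw_poly N X \<phi>2" "pw_poly N X \<psi>"
  shows "mesh_inner N X (\<lambda>x. \<phi>1 x - \<phi>2 x) \<psi> = mesh_inner N X \<phi>1 \<psi> - mesh_inner N X \<phi>2 \<psi>"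
  unfolding mesh_inner_def using assms
  by (simp add: left_diff_distrib mesh_integral_diff pw_poly_intros)

lemma mesh_inner_cmult_left: "mesh_inner N X (\<lambda>x. c * \<phi> x) \<psi> = c * mesh_inner N X \<phi> \<psi>"
  unfolding mesh_inner_def by (simp add: mult.assoc mesh_integral_cmult)

locale mesh =
  fixes N :: nat and X :: "nat \<Rightarrow> real"
  assumes N_ge_1: "1 \<le> N" and X_less: "\<And>i. i < N \<Longrightarrow> X i < X (Suc i)"
begin

lemma X_pred_less: "i \<in> {1..N} \<Longrightarrow> X (i - 1) < X i"
  using X_less [of "i - 1"] by (cases i) auto

section \<open>One-sided values at the nodes\<close>

lemma tendsto_at_left_node:
  assumes "i \<in> {1..N}" "\<forall>x\<in>elem X i. \<phi> x = poly P x"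
  shows "(\<phi> \<longlongrightarrow> poly P (X i)) (at_left (X i))"
proof (rule Lim_transform_eventually)
  show "(poly P \<longlongrightarrow> poly P (X i)) (at_left (X i))"
    using poly_isCont [of "X i" P] by (simp add: isCont_def filterlim_at_split)
  show "\<forall>\<^sub>F x in at_left (X i). poly P x = \<phi> x"
    using eventually_at_left_real [OF X_pred_less [OF assms(1)]] assms(2)
    by (simp add: elem_def eventually_mono)
qed

lemma tendsto_at_right_node:
  assumes "i \<in> {1..N}" "\<forall>x\<in>elem X i. \<phi> x = poly P x"
  shows "(\<phi> \<longlongrightarrow> poly P (X (i - 1))) (at_right (X (i - 1)))"
proof (rule Lim_transform_eventually)
  show "(poly P \<longlongrightarrow> poly P (X (i - 1))) (at_right (X (i - 1)))"
    using poly_isCont [of "X (i - 1)" P] by (simp add: isCont_def filterlim_at_split)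
  show "\<forall>\<^sub>F x in at_right (X (i - 1)). poly P x = \<phi> x"
    using eventually_at_right_real [OF X_pred_less [OF assms(1)]] assms(2)
    by (simp add: elem_def eventually_mono)
qed

lemma trace_minus_eq_poly:
  assumes "i \<in> {1..N}" "\<forall>x\<in>elem X i. \<phi> x = poly P x"
  shows "trace_minus N X \<phi> i = poly P (X i)"
  using tendsto_Lim [OF _ tendsto_at_left_node [OF assms]] assms(1) by (simp add: trace_minus_def)

lemma trace_plus_eq_poly:
  assumes "i \<in> {1..N}" "\<forall>x\<in>elem X i. \<phi> x = poly P x"
  shows "trace_plus N X \<phi> (i - 1) = poly P (X (i - 1))"
  using tendsto_Lim [OF _ tendsto_at_right_node [OF assms]] assms(1)
  by (auto simp add: trace_plus_def)

lemma trace_minus_0: "trace_minus N X \<phi> 0 = trace_minus N X \<phi> N"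
  by (simp add: trace_minus_def)

lemma trace_plus_N: "trace_plus N X \<phi> N = trace_plus N X \<phi> 0"
  by (simp add: trace_plus_def)

text \<open>The right value at node \<open>i\<close> is taken from element \<open>i + 1\<close>, or
  by periodicity from element \<open>1\<close> if \<open>i = N\<close>. The element \<open>j\<close>
  does not depend on the function, so sums and products can be treated on it together.\<close>

lemma trace_plus_shift:
  assumes "i \<in> {1..N}"
  obtains j where "j \<in> {1..N}" "\<forall>\<phi>. trace_plus N X \<phi> i = trace_plus N X \<phi> (j - 1)"
proof (cases "i = N")
  case True
  then show ?thesis
    using that [of 1] N_ge_1 trace_plus_N by simp
next
  case False
  then show ?thesis
    using that [of "Suc i"] assms by simp
qed

lemma trace_minus_combine:
  assumes "i \<in> {1..N}" "pw_poly N X \<phi>" "pw_poly N X \<psi>"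
  shows "trace_minus N X (\<lambda>x. \<phi> x + \<psi> x) i = trace_minus N X \<phi> i + trace_minus N X \<psi> i"
    and "trace_minus N X (\<lambda>x. \<phi> x * \<psi> x) i = trace_minus N X \<phi> i * trace_minus N X \<psi> i"
proof -
  obtain P where P: "\<forall>x\<in>elem X i. \<phi> x = poly P x"
    using assms(2,1) by (rule pw_polyE)
  obtain Q where Q: "\<forall>x\<in>elem X i. \<psi> x = poly Q x"
    using assms(3,1) by (rule pw_polyE)
  show "trace_minus N X (\<lambda>x. \<phi> x + \<psi> x) i = trace_minus N X \<phi> i + trace_minus N X \<psi> i"
    using P Q trace_minus_eq_poly [OF assms(1), of "\<lambda>x. \<phi> x + \<psi> x" "P + Q"]
    by (simp add: trace_minus_eq_poly [OF assms(1) P] trace_minus_eq_poly [OF assms(1) Q])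
  show "trace_minus N X (\<lambda>x. \<phi> x * \<psi> x) i = trace_minus N X \<phi> i * trace_minus N X \<psi> i"
    using P Q trace_minus_eq_poly [OF assms(1), of "\<lambda>x. \<phi> x * \<psi> x" "P * Q"]
    by (simp add: trace_minus_eq_poly [OF assms(1) P] trace_minus_eq_poly [OF assms(1) Q])
qed

lemma trace_plus_combine:
  assumes "i \<in> {1..N}" "pw_poly N X \<phi>" "pw_poly N X \<psi>"
  shows "trace_plus N X (\<lambda>x. \<phi> x + \<psi> x) i = trace_plus N X \<phi> i + trace_plus N X \<psi> i"
    and "trace_plus N X (\<lambda>x. \<phi> x * \<psi> x) i = trace_plus N X \<phi> i * trace_plus N X \<psi> i"
proof -
  obtain j where j: "j \<in> {1..N}" "\<forall>\<phi>. trace_plus N X \<phi> i = trace_plus N X \<phi> (j - 1)"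
    using assms(1) by (rule trace_plus_shift)
  obtain P where P: "\<forall>x\<in>elem X j. \<phi> x = poly P x"
    using assms(2) j(1) by (rule pw_polyE)
  obtain Q where Q: "\<forall>x\<in>elem X j. \<psi> x = poly Q x"
    using assms(3) j(1) by (rule pw_polyE)
  show "trace_plus N X (\<lambda>x. \<phi> x + \<psi> x) i = trace_plus N X \<phi> i + trace_plus N X \<psi> i"
    using P Q trace_plus_eq_poly [OF j(1), of "\<lambda>x. \<phi> x + \<psi> x" "P + Q"]
    by (simp add: j(2) trace_plus_eq_poly [OF j(1) P, simplified] trace_plus_eq_poly [OF j(1) Q, simplified])
  show "trace_plus N X (\<lambda>x. \<phi> x * \<psi> x) i = trace_plus N X \<phi> i * trace_plus N X \<psi> i"
    using P Q trace_plus_eq_poly [OF j(1), of "\<lambda>x. \<phi> x * \<psi> x" "P * Q"]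
    by (simp add: j(2) trace_plus_eq_poly [OF j(1) P, simplified] trace_plus_eq_poly [OF j(1) Q, simplified])
qed

lemma trace_minus_const: "trace_minus N X (\<lambda>x. c) i = c"
  by (simp add: trace_minus_def tendsto_Lim)

lemma trace_plus_const: "trace_plus N X (\<lambda>x. c) i = c"
  by (simp add: trace_plus_def tendsto_Lim)

lemmas trace_simps = trace_minus_combine trace_plus_combine trace_minus_const trace_plus_const
  pw_poly_const

lemma jump_mult:
  assumes "i \<in> {1..N}" "pw_poly N X \<phi>" "pw_poly N X \<psi>"
  shows "jump N X (\<lambda>x. \<phi> x * \<psi> x) i = jump N X \<phi> i * avg N X \<psi> i + jump N X \<psi> i * avg N X \<phi> i"
  using assms by (simp add: jump_def avg_def trace_simps field_simps)

lemma jump_add: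
  assumes "i \<in> {1..N}" "pw_poly N X \<phi>" "pw_poly N X \<psi>"
  shows "jump N X (\<lambda>x. \<phi> x + \<psi> x) i = jump N X \<phi> i + jump N X \<psi> i"
  using assms by (simp add: jump_def trace_simps)

text \<open>Regroups contributions of left endpoints by nodes: the two sums differ only in the terms
  at nodes \<open>0\<close> and \<open>N\<close>, which agree.\<close>

lemma periodic_sum_shift:
  fixes g :: "nat \<Rightarrow> real"
  assumes "g 0 = g N"
  shows "(\<Sum>i=1..N. g (i - 1)) = (\<Sum>i=1..N. g i)"
proof -
  have "(\<Sum>i=1..N. g (i - 1)) = (\<Sum>i<N. g i)"
    by (rule sum.reindex_bij_witness [of _ Suc "\<lambda>i. i - 1"]) auto
  also have "\<dots> = (\<Sum>i<N. g (Suc i))"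
    using sum.lessThan_Suc [of g N] sum.lessThan_Suc_shift [of g N] assms by simp
  also have "\<dots> = (\<Sum>i=1..N. g i)"
    by (rule sum.reindex_bij_witness [of _ "\<lambda>i. i - 1" Suc]) auto
  finally show ?thesis .
qed

text \<open>Each node receives the left value from one element and minus the right value from the
  next, both weighted by the same \<open>g i\<close>; periodicity joins the two ends.\<close>

lemma bdry_eq_sum_jump:
  assumes "g 0 = g N"
  shows "bdry N X g \<phi> = (\<Sum>i=1..N. g i * jump N X \<phi> i)"
  using periodic_sum_shift [of "\<lambda>i. g i * trace_plus N X \<phi> i"] assms
  by (simp add: bdry_def jump_def right_diff_distrib sum_subtractf trace_plus_N)

lemma avg_0: "avg N X \<phi> 0 = avg N X \<phi> N"
  by (simp add: avg_def trace_minus_0 trace_plus_N)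

lemma jump_0: "jump N X \<phi> 0 = jump N X \<phi> N"
  by (simp add: jump_def trace_minus_0 trace_plus_N)

section \<open>Summation by parts on the periodic mesh\<close>

lemma integral_deriv_elem:
  assumes "pw_poly N X \<phi>" and i: "i \<in> {1..N}"
  shows "integral (elem X i) (deriv \<phi>) = trace_minus N X \<phi> i - trace_plus N X \<phi> (i - 1)"
proof -
  obtain P where P: "\<forall>x\<in>elem X i. \<phi> x = poly P x"
    using assms by (rule pw_polyE)
  have "integral (elem X i) (deriv \<phi>) = integral (elem X i) (poly (pderiv P))"
    using P by (intro Henstock_Kurzweil_Integration.integral_cong deriv_on_elem)
  also have "\<dots> = integral {X (i - 1)..X i} (poly (pderiv P))"
    by (simp add: elem_def integral_open_interval_real)
  also have "\<dots> = poly P (X i) - poly P (X (i - 1))"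
  proof (intro integral_unique fundamental_theorem_of_calculus)
    show "X (i - 1) \<le> X i"
      using X_pred_less [OF i] by simp
    show "(poly P has_vector_derivative poly (pderiv P) x) (at x within {X (i - 1)..X i})" for x
      using poly_DERIV [of P x]
      by (simp add: has_real_derivative_iff_has_vector_derivative has_vector_derivative_at_within)
  qed
  finally show ?thesis
    using trace_minus_eq_poly [OF i P] trace_plus_eq_poly [OF i P] by simp
qed

lemma mesh_integral_deriv:
  assumes "pw_poly N X \<phi>"
  shows "mesh_integral N X (deriv \<phi>) = (\<Sum>i=1..N. jump N X \<phi> i)"
  unfolding mesh_integral_def
  using periodic_sum_shift [of "trace_plus N X \<phi>"] integral_deriv_elem [OF assms]
  by (simp add: sum_subtractf jump_def trace_plus_N)

lemma mesh_inner_by_parts: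
  assumes "pw_poly N X \<phi>" "pw_poly N X \<psi>"
  shows "mesh_inner N X (deriv \<phi>) \<psi> + mesh_inner N X \<phi> (deriv \<psi>)
    = (\<Sum>i=1..N. jump N X (\<lambda>x. \<phi> x * \<psi> x) i)"
proof -
  have "mesh_inner N X (deriv \<phi>) \<psi> + mesh_inner N X \<phi> (deriv \<psi>)
      = mesh_integral N X (\<lambda>x. deriv \<phi> x * \<psi> x + \<phi> x * deriv \<psi> x)"
    unfolding mesh_inner_def using assms by (simp add: mesh_integral_add pw_poly_intros)
  also have "\<dots> = mesh_integral N X (deriv (\<lambda>x. \<phi> x * \<psi> x))"
    using assms by (intro mesh_integral_cong) (simp add: deriv_mult_on_elem)
  also have "\<dots> = (\<Sum>i=1..N. jump N X (\<lambda>x. \<phi> x * \<psi> x) i)"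
    using assms by (intro mesh_integral_deriv pw_poly_intros)
  finally show ?thesis .
qed

text \<open>The two volume terms add up to the sum of the jumps of the product, and [fg] = [f]{g} +
  [g]{f} is exactly what the trace terms subtract.\<close>

lemma weak_deriv_antisym:
  assumes "pw_poly N X \<phi>" "pw_poly N X \<psi>"
  shows "weak_deriv N X \<phi> \<psi> = - weak_deriv N X \<psi> \<phi>"
  using mesh_inner_by_parts [OF assms] assms
  by (simp add: weak_deriv_def jump_mult sum.distrib mesh_inner_commute [of _ _ \<phi>])

lemma weak_deriv_self:
  assumes "pw_poly N X \<phi>"
  shows "weak_deriv N X \<phi> \<phi> = 0"
  using weak_deriv_antisym [OF assms assms] by simp

text \<open>The form with the derivative on the test function, as it occurs in the scheme with
  averaged numerical traces.\<close>

lemma weak_deriv_eq_bdry: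
  assumes "pw_poly N X \<phi>" "pw_poly N X \<psi>"
  shows "weak_deriv N X \<phi> \<psi> = bdry N X (avg N X \<phi>) \<psi> - mesh_inner N X \<phi> (deriv \<psi>)"
  using mesh_inner_by_parts [OF assms] assms
  by (simp add: weak_deriv_def jump_mult sum.distrib bdry_eq_sum_jump avg_0 mult.commute)

subsection \<open>The projection\<close>

lemma elem_disjoint:
  assumes "i \<in> {1..N}" "j \<in> {1..N}" "x \<in> elem X i" "x \<in> elem X j"
  shows "i = j"
proof -
  have mono: "X m \<le> X n" if "m \<le> n" "n \<le> N" for m n
    using that
  proof (induction n rule: dec_induct)
    case (step n)
    then show ?case
      using X_less [of n] by simp
  qed simp
  show ?thesis
  proof (rule ccontr)
    assume "i \<noteq> j"
    then consider "i \<le> j - 1" | "j \<le> i - 1"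
      by linarith
    then show False
    proof cases
      case 1
      then have "X i \<le> X (j - 1)"
        using assms(2) by (intro mono) auto
      then show False
        using assms(3,4) by (simp add: elem_def)
    next
      case 2
      then have "X j \<le> X (i - 1)"
        using assms(1) by (intro mono) auto
      then show False
        using assms(3,4) by (simp add: elem_def)
    qed
  qed
qed

text \<open>Without continuity between elements, the projection can be computed on each element and
  glued. This justifies the choice operator in \<open>proj\<close>.\<close>

lemma proj_exists:
  assumes "pw_poly N X g"
  shows "\<exists>\<phi>. \<phi> \<in> dg_space N X k \<and> (\<forall>v\<in>dg_space N X k. mesh_inner N X (\<lambda>x. g x - \<phi> x) v = 0)"
proof -
  have "\<exists>P. degree P \<le> k \<and>
      (\<forall>v\<in>dg_space N X k. integral (elem X i) (\<lambda>x. (g x - poly P x) * v x) = 0)"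
    if i: "i \<in> {1..N}" for i
  proof -
    obtain G where G: "\<forall>x\<in>elem X i. g x = poly G x"
      using assms i by (rule pw_polyE)
    obtain P where deg: "\<forall>j\<ge>Suc k. coeff P j = 0"
      and orth: "\<And>Q. \<forall>j\<ge>Suc k. coeff Q j = 0 \<Longrightarrow> integral (elem X i) (poly ((G - P) * Q)) = 0"
      unfolding elem_def using poly_projection_exists [OF X_pred_less [OF i]] by blast
    have "integral (elem X i) (\<lambda>x. (g x - poly P x) * v x) = 0" if v: "v \<in> dg_space N X k" for v
    proof -
      obtain Q where "degree Q \<le> k" and Q: "\<forall>x\<in>elem X i. v x = poly Q x"
        using v i unfolding dg_space_def by blast
      then have "\<forall>j\<ge>Suc k. coeff Q j = 0"
        by (simp add: coeff_eq_0)
      from orth [OF this] show ?thesis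
        using G Q Henstock_Kurzweil_Integration.integral_cong
          [of "elem X i" "\<lambda>x. (g x - poly P x) * v x" "poly ((G - P) * Q)"] by simp
    qed
    moreover have "degree P \<le> k"
      using deg by (simp add: degree_le)
    ultimately show ?thesis
      by blast
  qed
  then obtain P where deg: "\<And>i. i \<in> {1..N} \<Longrightarrow> degree (P i) \<le> k" and orth: "\<And>i v. i \<in> {1..N} \<Longrightarrow>
      v \<in> dg_space N X k \<Longrightarrow> integral (elem X i) (\<lambda>x. (g x - poly (P i) x) * v x) = 0"
    by metis
  \<comment> \<open>The elements are disjoint, so inside an element \<open>THE\<close> finds its
    index; the values elsewhere do not matter.\<close>
  define \<phi> where "\<phi> x = poly (P (THE i. i \<in> {1..N} \<and> x \<in> elem X i)) x" for x
  have \<phi>: "\<phi> x = poly (P i) x" if "i \<in> {1..N}" "x \<in> elem X i" for i x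
  proof -
    have "(THE i. i \<in> {1..N} \<and> x \<in> elem X i) = i"
      using that elem_disjoint by blast
    then show ?thesis
      by (simp add: \<phi>_def)
  qed
  have "\<phi> \<in> dg_space N X k"
    unfolding dg_space_def using \<phi> deg by blast
  moreover have "mesh_inner N X (\<lambda>x. g x - \<phi> x) v = 0" if "v \<in> dg_space N X k" for v
    unfolding mesh_inner_def mesh_integral_def
  proof (intro sum.neutral ballI)
    fix i assume i: "i \<in> {1..N}"
    have "integral (elem X i) (\<lambda>x. (g x - \<phi> x) * v x)
        = integral (elem X i) (\<lambda>x. (g x - poly (P i) x) * v x)"
      using \<phi> [OF i] by (intro Henstock_Kurzweil_Integration.integral_cong) simp
    with orth [OF i that] show "integral (elem X i) (\<lambda>x. (g x - \<phi> x) * v x) = 0"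
      by simp
  qed
  ultimately show ?thesis
    by blast
qed

lemma proj_in_dg_space: "pw_poly N X g \<Longrightarrow> proj N X k g \<in> dg_space N X k"
  unfolding proj_def using someI_ex [OF proj_exists] by blast

lemma mesh_inner_proj:
  assumes "pw_poly N X g" "v \<in> dg_space N X k"
  shows "mesh_inner N X v (proj N X k g) = mesh_inner N X v g"
proof -
  have "mesh_inner N X (\<lambda>x. g x - proj N X k g x) v = 0"
    using someI_ex [OF proj_exists [OF assms(1), of k]] assms(2) unfolding proj_def by blast
  then show ?thesis
    using mesh_inner_diff_left [OF assms(1), of "proj N X k g" v] assms
    by (simp add: pw_poly_dg_space proj_in_dg_space pw_poly_dg_space [OF proj_in_dg_space]
        mesh_inner_commute [of _ _ v])
qed

text \<open>Against the derivative of \<open>\<phi>\<close>, which stays in the discrete space, the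
  projection may be dropped; in the traces it remains.\<close>

lemma weak_deriv_proj:
  assumes "\<phi> \<in> dg_space N X k" "pw_poly N X g"
  shows "weak_deriv N X \<phi> (proj N X k g)
    = mesh_inner N X (deriv \<phi>) g - (\<Sum>i=1..N. jump N X \<phi> i * avg N X (proj N X k g) i)"
  unfolding weak_deriv_def using mesh_inner_proj [OF assms(2) dg_space_deriv [OF assms(1)]] by simp

text \<open>The part of \<open>Theta\<close> without projections is the jump of the triple product.
  Its sum is, by parts and the product rule, the sum of three volume terms; each of them pairs with
  one projected trace term.\<close>

lemma sum_Theta:
  assumes "\<phi>1 \<in> dg_space N X k" "\<phi>2 \<in> dg_space N X k" "\<phi>3 \<in> dg_space N X k"
  shows "(\<Sum>i=1..N. Theta N X k \<phi>1 \<phi>2 \<phi>3 i)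
    = weak_deriv N X \<phi>1 (proj N X k (\<lambda>x. \<phi>2 x * \<phi>3 x))
    + weak_deriv N X \<phi>2 (proj N X k (\<lambda>x. \<phi>1 x * \<phi>3 x))
    + weak_deriv N X \<phi>3 (proj N X k (\<lambda>x. \<phi>1 x * \<phi>2 x))"
proof -
  note pw = assms [THEN pw_poly_dg_space]
  have "mesh_inner N X (deriv (\<lambda>x. \<phi>2 x * \<phi>3 x)) \<phi>1
      = mesh_integral N X (\<lambda>x. deriv \<phi>2 x * (\<phi>1 x * \<phi>3 x) + deriv \<phi>3 x * (\<phi>1 x * \<phi>2 x))"
    unfolding mesh_inner_def using pw
    by (intro mesh_integral_cong) (simp add: deriv_mult_on_elem algebra_simps)
  also have "\<dots> = mesh_inner N X (deriv \<phi>2) (\<lambda>x. \<phi>1 x * \<phi>3 x)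
      + mesh_inner N X (deriv \<phi>3) (\<lambda>x. \<phi>1 x * \<phi>2 x)"
    unfolding mesh_inner_def using pw by (simp add: mesh_integral_add pw_poly_intros)
  finally have "(\<Sum>i=1..N. jump N X \<phi>1 i * avg N X (\<lambda>x. \<phi>2 x * \<phi>3 x) i
        + jump N X (\<lambda>x. \<phi>2 x * \<phi>3 x) i * avg N X \<phi>1 i)
      = mesh_inner N X (deriv \<phi>1) (\<lambda>x. \<phi>2 x * \<phi>3 x)
      + mesh_inner N X (deriv \<phi>2) (\<lambda>x. \<phi>1 x * \<phi>3 x)
      + mesh_inner N X (deriv \<phi>3) (\<lambda>x. \<phi>1 x * \<phi>2 x)"
    using mesh_inner_by_parts [OF pw(1) pw_poly_mult [OF pw(2,3)]] pw
    by (simp add: jump_mult [OF _ pw(1) pw_poly_mult [OF pw(2,3)]] mesh_inner_commute [of _ _ \<phi>1])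
  then show ?thesis
    using assms pw by (simp add: Theta_def weak_deriv_proj pw_poly_intros sum.distrib sum_subtractf)
qed

end

subsection \<open>Differentiation in time\<close>

lemma has_real_derivative_cong_within:
  fixes g h :: "real \<Rightarrow> real"
  assumes "(g has_real_derivative D) (at t within J)" "\<And>s. s \<in> J \<Longrightarrow> g s = h s" "t \<in> J"
  shows "(h has_real_derivative D) (at t within J)"
  using assms by (intro has_field_derivative_transform_within [OF assms(1), of 1]) auto

lemma has_real_derivative_unique_within:
  fixes g :: "real \<Rightarrow> real"
  assumes "(g has_real_derivative D) (at t within J)" "(g has_real_derivative D') (at t within J)"
    and "at t within J \<noteq> bot"
  shows "D = D'"
  using assms vector_derivative_unique_within
  unfolding has_real_derivative_iff_has_vector_derivative by blast

context mesh
begin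

text \<open>The interpolation points lie inside the open element, where differentiability in time is
  available, and one basis serves all members of the space.\<close>

lemma dg_space_nodal_basis:
  assumes i: "i \<in> {1..N}"
  obtains A L where "A \<subseteq> elem X i" "\<forall>y\<in>A. degree (L y) \<le> k"
    "\<forall>\<phi>\<in>dg_space N X k. \<forall>x\<in>elem X i. \<phi> x = poly (\<Sum>y\<in>A. smult (\<phi> y) (L y)) x"
proof -
  have "infinite (elem X i)"
    using X_pred_less [OF i] by (simp add: elem_def)
  then obtain A where A: "finite A" "card A = Suc k" "A \<subseteq> elem X i"
    using infinite_arbitrarily_large by blast
  obtain L where L: "\<And>y. y \<in> A \<Longrightarrow> degree (L y) \<le> k"
    "\<And>P. degree P \<le> k \<Longrightarrow> P = (\<Sum>y\<in>A. smult (poly P y) (L y))"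
    using Lagrange_basis_exists [OF A(1,2)] by blast
  have "\<phi> x = poly (\<Sum>y\<in>A. smult (\<phi> y) (L y)) x"
    if \<phi>: "\<phi> \<in> dg_space N X k" and x: "x \<in> elem X i" for \<phi> x
  proof -
    obtain P where P: "degree P \<le> k" "\<forall>x\<in>elem X i. \<phi> x = poly P x"
      using \<phi> i unfolding dg_space_def by blast
    have "(\<Sum>y\<in>A. smult (\<phi> y) (L y)) = (\<Sum>y\<in>A. smult (poly P y) (L y))"
      using P(2) A(3) by (intro sum.cong) auto
    with L(2) [OF P(1)] P(2) x show ?thesis
      by simp
  qed
  then show ?thesis
    using that [of A L] A(3) L(1) by blast
qed

end

text \<open>A curve in the finite-dimensional space \<open>dg_space N X k\<close> that is differentiable pointwise is
  differentiable in any norm: its coefficients in a nodal basis are point values.\<close>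

locale dg_curve = mesh +
  fixes k :: nat and J :: "real set" and t :: real and F :: "real \<Rightarrow> real \<Rightarrow> real" and F' :: "real \<Rightarrow> real"
  assumes F_dg: "\<And>s. s \<in> J \<Longrightarrow> F s \<in> dg_space N X k" and t_in: "t \<in> J"
    and nontrivial: "at t within J \<noteq> bot"
    and F_deriv: "\<And>i x. i \<in> {1..N} \<Longrightarrow> x \<in> elem X i \<Longrightarrow>
      ((\<lambda>s. F s x) has_real_derivative F' x) (at t within J)"
begin

text \<open>The expansion of \<open>F'\<close> results from differentiating that of
  \<open>F s\<close> at fixed \<open>x\<close>: its coefficients are point values, and derivatives
  within \<open>J\<close> are unique.\<close>

lemma elem_expansion:
  assumes i: "i \<in> {1..N}"
  obtains A L where "\<forall>y\<in>A. degree (L y) \<le> k"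
    "\<forall>y\<in>A. ((\<lambda>s. F s y) has_real_derivative F' y) (at t within J)"
    "\<forall>s\<in>J. \<forall>x\<in>elem X i. F s x = poly (\<Sum>y\<in>A. smult (F s y) (L y)) x"
    "\<forall>x\<in>elem X i. F' x = poly (\<Sum>y\<in>A. smult (F' y) (L y)) x"
proof -
  obtain A L where A: "A \<subseteq> elem X i" and L: "\<forall>y\<in>A. degree (L y) \<le> k"
    and "\<forall>\<phi>\<in>dg_space N X k. \<forall>x\<in>elem X i. \<phi> x = poly (\<Sum>y\<in>A. smult (\<phi> y) (L y)) x"
    using i by (rule dg_space_nodal_basis)
  then have expand: "\<phi> x = poly (\<Sum>y\<in>A. smult (\<phi> y) (L y)) x"
    if "\<phi> \<in> dg_space N X k" "x \<in> elem X i" for \<phi> x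
    using that by blast
  have A_deriv: "((\<lambda>s. F s y) has_real_derivative F' y) (at t within J)" if "y \<in> A" for y
    using F_deriv [OF i] A that by blast
  have "F' x = poly (\<Sum>y\<in>A. smult (F' y) (L y)) x" if x: "x \<in> elem X i" for x
  proof (rule has_real_derivative_unique_within [OF F_deriv [OF i x] _ nontrivial])
    have "((\<lambda>s. \<Sum>y\<in>A. F s y * poly (L y) x) has_real_derivative (\<Sum>y\<in>A. F' y * poly (L y) x)) (at t within J)"
      using A_deriv by (intro DERIV_sum DERIV_cmult_right)
    then show "((\<lambda>s. F s x) has_real_derivative poly (\<Sum>y\<in>A. smult (F' y) (L y)) x) (at t within J)"
      unfolding poly_sum poly_smult
      by (rule has_real_derivative_cong_within) (simp_all add: expand [OF F_dg x] poly_sum t_in)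
  qed
  then show ?thesis
    using that [of A L] L A_deriv expand [OF F_dg] by blast
qed

text \<open>Makes the time derivative admissible as a test function in the scheme.\<close>

lemma deriv_in_dg_space: "F' \<in> dg_space N X k"
  unfolding dg_space_def
proof clarify
  fix i assume "i \<in> {1..N}"
  then obtain A L where L: "\<forall>y\<in>A. degree (L y) \<le> k"
      and F': "\<forall>x\<in>elem X i. F' x = poly (\<Sum>y\<in>A. smult (F' y) (L y)) x"
    by (rule elem_expansion)
  \<comment> \<open>Finiteness of \<open>A\<close> is not part of the expansion; for infinite
    \<open>A\<close> the sum is 0 by convention.\<close>
  have "degree (\<Sum>y\<in>A. smult (F' y) (L y)) \<le> k"
    using L by (cases "finite A") (auto intro!: degree_sum_le simp: degree_smult_le [THEN order_trans])
  with F' show "\<exists>P. degree P \<le> k \<and> (\<forall>x\<in>elem X i. F' x = poly P x)"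
    by blast
qed

text \<open>Any functional that sees only the polynomial on one element, and sees it linearly
  through \<open>m\<close>, becomes a fixed linear combination of nodal values. Integrals over an
  element and one-sided traces are of this kind.\<close>

lemma DERIV_functional:
  assumes i: "i \<in> {1..N}"
    and l: "\<And>\<phi> P. \<forall>x\<in>elem X i. \<phi> x = poly P x \<Longrightarrow> l \<phi> = m P"
    and m_add: "\<And>P Q. m (P + Q) = m P + m Q" and m_smult: "\<And>c P. m (smult c P) = c * m P"
  shows "((\<lambda>s. l (F s)) has_real_derivative l F') (at t within J)"
proof -
  obtain A L where A_deriv: "\<forall>y\<in>A. ((\<lambda>s. F s y) has_real_derivative F' y) (at t within J)"
    and F: "\<forall>s\<in>J. \<forall>x\<in>elem X i. F s x = poly (\<Sum>y\<in>A. smult (F s y) (L y)) x"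
    and F': "\<forall>x\<in>elem X i. F' x = poly (\<Sum>y\<in>A. smult (F' y) (L y)) x"
    using i by (rule elem_expansion)
  have "m 0 = 0"
    using m_smult [of 0 0] by simp
  then have m_sum: "m (\<Sum>y\<in>A. smult (c y) (L y)) = (\<Sum>y\<in>A. c y * m (L y))" for c
    by (induction A rule: infinite_finite_induct) (simp_all add: m_add m_smult)
  have "((\<lambda>s. \<Sum>y\<in>A. F s y * m (L y)) has_real_derivative (\<Sum>y\<in>A. F' y * m (L y))) (at t within J)"
    using A_deriv by (intro DERIV_sum DERIV_cmult_right) blast
  then show ?thesis
    unfolding l [OF F'] m_sum
    by (rule has_real_derivative_cong_within) (simp_all add: l [OF bspec [OF F]] m_sum t_in)
qed

lemma DERIV_mesh_integral:
  "((\<lambda>s. mesh_integral N X (F s)) has_real_derivative mesh_integral N X F') (at t within J)"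
  unfolding mesh_integral_def
proof (intro DERIV_sum)
  fix i assume i: "i \<in> {1..N}"
  show "((\<lambda>s. integral (elem X i) (F s)) has_real_derivative integral (elem X i) F') (at t within J)"
  proof (rule DERIV_functional [OF i, where m = "\<lambda>P. integral (elem X i) (poly P)"])
    show "integral (elem X i) (poly (P + Q)) = integral (elem X i) (poly P) + integral (elem X i) (poly Q)"
      for P Q
      unfolding elem_def using integral_add [OF poly_integrable_Ioo [of P] poly_integrable_Ioo [of Q]]
      by (simp add: poly_add [abs_def])
    show "integral (elem X i) (poly (smult c P)) = c * integral (elem X i) (poly P)" for c P
      by (simp add: poly_smult [abs_def])
    show "integral (elem X i) \<phi> = integral (elem X i) (poly P)"
      if "\<forall>x\<in>elem X i. \<phi> x = poly P x" for \<phi> P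
      using that by (intro Henstock_Kurzweil_Integration.integral_cong) simp
  qed
qed

lemma DERIV_trace_minus:
  assumes "i \<in> {1..N}"
  shows "((\<lambda>s. trace_minus N X (F s) i) has_real_derivative trace_minus N X F' i) (at t within J)"
  using assms
  by (rule DERIV_functional [where m = "\<lambda>P. poly P (X i)"]) (simp_all add: trace_minus_eq_poly [OF assms])

lemma DERIV_trace_plus:
  assumes "i \<in> {1..N}"
  shows "((\<lambda>s. trace_plus N X (F s) i) has_real_derivative trace_plus N X F' i) (at t within J)"
proof -
  obtain j where j: "j \<in> {1..N}" "\<forall>\<phi>. trace_plus N X \<phi> i = trace_plus N X \<phi> (j - 1)"
    using assms by (rule trace_plus_shift)
  show ?thesis
    unfolding spec [OF j(2)] using j(1)
    by (rule DERIV_functional [where m = "\<lambda>P. poly P (X (j - 1))"])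
      (simp_all only: trace_plus_eq_poly [OF j(1)] poly_add poly_smult)
qed

lemma DERIV_mesh_inner:
  assumes "\<phi> \<in> dg_space N X m"
  shows "((\<lambda>s. mesh_inner N X (F s) \<phi>) has_real_derivative mesh_inner N X F' \<phi>) (at t within J)"
proof -
  \<comment> \<open>Multiplication by a fixed piecewise polynomial yields a differentiable curve
    again, in a space of higher degree.\<close>
  interpret prod: dg_curve N X "k + m" J t "\<lambda>s x. F s x * \<phi> x" "\<lambda>x. F' x * \<phi> x"
    using F_dg assms t_in nontrivial F_deriv
    by unfold_locales (auto intro: dg_space_mult DERIV_cmult_right)
  show ?thesis
    unfolding mesh_inner_def by (rule prod.DERIV_mesh_integral)
qed

lemma DERIV_weak_deriv:
  assumes "\<phi> \<in> dg_space N X m"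
  shows "((\<lambda>s. weak_deriv N X (F s) \<phi>) has_real_derivative weak_deriv N X F' \<phi>) (at t within J)"
proof -
  \<comment> \<open>Moving the spatial derivative onto the fixed \<open>\<phi>\<close> leaves only
    traces and inner products of the curve to differentiate.\<close>
  have eq: "weak_deriv N X G \<phi>
      = (\<Sum>i=1..N. (trace_minus N X G i + trace_plus N X G i) / 2 * jump N X \<phi> i)
        - mesh_inner N X G (deriv \<phi>)" if "G \<in> dg_space N X k" for G
    using weak_deriv_eq_bdry [of G \<phi>] that assms
    by (simp add: pw_poly_dg_space bdry_eq_sum_jump avg_0) (simp add: avg_def)
  have "((\<lambda>s. (\<Sum>i=1..N. (trace_minus N X (F s) i + trace_plus N X (F s) i) / 2 * jump N X \<phi> i)
        - mesh_inner N X (F s) (deriv \<phi>)) has_real_derivative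
      (\<Sum>i=1..N. (trace_minus N X F' i + trace_plus N X F' i) / 2 * jump N X \<phi> i)
        - mesh_inner N X F' (deriv \<phi>)) (at t within J)"
    by (intro DERIV_diff DERIV_sum DERIV_cmult_right DERIV_cdivide DERIV_add DERIV_trace_minus
        DERIV_trace_plus DERIV_mesh_inner [OF dg_space_deriv [OF assms]])
  then show ?thesis
    unfolding eq [OF deriv_in_dg_space]
    by (rule has_real_derivative_cong_within) (simp_all add: eq F_dg t_in)
qed

end

subsection \<open>Conservation laws\<close>

context mesh
begin

lemma jump_const: "jump N X (\<lambda>x. c) i = 0"
  by (simp add: jump_def trace_minus_const trace_plus_const)

text \<open>The fundamental theorem on each element, since the derivative of the cube is 3 f^2 f_x.
  It evaluates the jumps of \<open>V(u)\<close>, as \<open>V\<close> is the cube up to a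
  constant.\<close>

lemma sum_jump_cube:
  assumes "pw_poly N X \<phi>"
  shows "(\<Sum>i=1..N. jump N X (\<lambda>x. \<phi> x ^ 3) i) = mesh_inner N X (deriv \<phi>) (\<lambda>x. 3 * (\<phi> x)\<^sup>2)"
proof -
  have "(\<Sum>i=1..N. jump N X (\<lambda>x. \<phi> x * (\<phi> x * \<phi> x)) i)
      = mesh_integral N X (deriv (\<lambda>x. \<phi> x * (\<phi> x * \<phi> x)))"
    using assms by (intro mesh_integral_deriv [symmetric] pw_poly_intros)
  also have "\<dots> = mesh_inner N X (deriv \<phi>) (\<lambda>x. 3 * (\<phi> x)\<^sup>2)"
    unfolding mesh_inner_def using assms
    by (intro mesh_integral_cong)
      (simp add: deriv_mult_on_elem pw_poly_intros power2_eq_square algebra_simps)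
  finally show ?thesis
    by (simp add: power3_eq_cube mult.assoc)
qed

end

text \<open>All numerical traces of the scheme are averages except that of \<open>p\<close>,
  whose penalty is \<open>T\<close>; the weak derivative form absorbs the averages.\<close>

locale hs_kdv_weak = mesh +
  fixes k :: nat and a b :: real and u q p w r v ut vt :: "real \<Rightarrow> real" and T :: "nat \<Rightarrow> real"
  assumes dg: "u \<in> dg_space N X k" "q \<in> dg_space N X k" "p \<in> dg_space N X k" "w \<in> dg_space N X k"
      "r \<in> dg_space N X k" "v \<in> dg_space N X k" "ut \<in> dg_space N X k" "vt \<in> dg_space N X k"
    and T_periodic: "T 0 = T N"
    and scheme: "hs_kdv_dg N X k a b u q p w r v ut vt (avg N X u) (avg N X q)
        (\<lambda>i. avg N X p i + T i) (avg N X v) (avg N X w) (avg N X r)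
        (avg N X (proj N X k (\<lambda>x. (v x)\<^sup>2)))"
begin

abbreviation inner_h where "inner_h \<equiv> mesh_inner N X"
abbreviation D where "D \<equiv> weak_deriv N X"
abbreviation proj_h where "proj_h \<equiv> proj N X k"

lemmas pw = dg [THEN pw_poly_dg_space]

lemma pw_proj: "pw_poly N X g \<Longrightarrow> pw_poly N X (proj_h g)"
  by (rule pw_poly_dg_space [OF proj_in_dg_space])

section \<open>The scheme in terms of the weak derivative form\<close>

lemma q_eq: "\<alpha> \<in> dg_space N X k \<Longrightarrow> inner_h q \<alpha> = D u \<alpha>"
  using scheme pw by (auto simp: hs_kdv_dg_def weak_deriv_eq_bdry pw_poly_dg_space algebra_simps)

lemma p_eq: "\<beta> \<in> dg_space N X k \<Longrightarrow> inner_h p \<beta> = D q \<beta> + 3 * inner_h (\<lambda>x. (u x)\<^sup>2) \<beta>"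
  using scheme pw
  by (auto simp: hs_kdv_dg_def weak_deriv_eq_bdry pw_poly_dg_space mesh_inner_cmult_left algebra_simps)

lemma w_eq: "\<xi> \<in> dg_space N X k \<Longrightarrow> inner_h w \<xi> = D v \<xi>"
  using scheme pw by (auto simp: hs_kdv_dg_def weak_deriv_eq_bdry pw_poly_dg_space algebra_simps)

lemma r_eq: "\<psi> \<in> dg_space N X k \<Longrightarrow> inner_h r \<psi> = D w \<psi>"
  using scheme pw by (auto simp: hs_kdv_dg_def weak_deriv_eq_bdry pw_poly_dg_space algebra_simps)

lemma vt_eq:
  assumes "\<phi> \<in> dg_space N X k"
  shows "inner_h vt \<phi> = - D r \<phi> - 3 * inner_h (\<lambda>x. u x * w x) \<phi>"
proof -
  have "inner_h vt \<phi> - inner_h r (deriv \<phi>) + bdry N X (avg N X r) \<phi>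
      + inner_h (\<lambda>x. 3 * (u x * w x)) \<phi> = 0"
    using scheme assms by (simp add: hs_kdv_dg_def mult.assoc)
  then show ?thesis
    using assms pw by (simp add: weak_deriv_eq_bdry pw_poly_dg_space mesh_inner_cmult_left)
qed

text \<open>Antisymmetry puts the test function first, where \<open>q_eq\<close> and
  \<open>sum_Theta\<close> can be applied.\<close>

lemma ut_eq:
  assumes "\<gamma> \<in> dg_space N X k"
  shows "inner_h ut \<gamma> = - a * D \<gamma> p - b * D \<gamma> (proj_h (\<lambda>x. (v x)\<^sup>2)) + a * (\<Sum>i=1..N. T i * jump N X \<gamma> i)"
proof -
  have "inner_h ut \<gamma> + inner_h (\<lambda>x. a * p x + b * (v x)\<^sup>2) (deriv \<gamma>)
      - bdry N X (\<lambda>i. a * (avg N X p i + T i) + b * avg N X (proj_h (\<lambda>x. (v x)\<^sup>2)) i) \<gamma> = 0"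
    using scheme assms unfolding hs_kdv_dg_def by blast
  moreover have "inner_h (\<lambda>x. a * p x + b * (v x)\<^sup>2) (deriv \<gamma>)
      = a * inner_h p (deriv \<gamma>) + b * inner_h (proj_h (\<lambda>x. (v x)\<^sup>2)) (deriv \<gamma>)"
  proof -
    \<comment> \<open>The derivative of the test function lies in the discrete space and does not
      distinguish the square from its projection.\<close>
    have "inner_h (\<lambda>x. (v x)\<^sup>2) (deriv \<gamma>) = inner_h (proj_h (\<lambda>x. (v x)\<^sup>2)) (deriv \<gamma>)"
      using mesh_inner_proj [of "\<lambda>x. (v x)\<^sup>2" "deriv \<gamma>" k] pw assms
      by (simp add: pw_poly_intros dg_space_deriv mesh_inner_commute [of _ _ "deriv \<gamma>"])
    then show ?thesis
      using pw assms
      by (simp add: mesh_inner_add_left mesh_inner_cmult_left pw_poly_intros pw_poly_dg_space dg_space_deriv)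
  qed
  moreover have "bdry N X (\<lambda>i. a * (avg N X p i + T i) + b * avg N X (proj_h (\<lambda>x. (v x)\<^sup>2)) i) \<gamma>
      = a * bdry N X (avg N X p) \<gamma> + a * (\<Sum>i=1..N. T i * jump N X \<gamma> i)
        + b * bdry N X (avg N X (proj_h (\<lambda>x. (v x)\<^sup>2))) \<gamma>"
    by (simp add: bdry_eq_sum_jump avg_0 T_periodic sum_distrib_left sum.distrib algebra_simps)
  ultimately show ?thesis
    using weak_deriv_eq_bdry [OF pw(3) pw_poly_dg_space [OF assms]] weak_deriv_antisym [OF pw(3) pw_poly_dg_space [OF assms]]
      weak_deriv_eq_bdry [OF pw_proj pw_poly_dg_space [OF assms], of "\<lambda>x. (v x)\<^sup>2"]
      weak_deriv_antisym [OF pw_proj pw_poly_dg_space [OF assms], of "\<lambda>x. (v x)\<^sup>2"] pw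
    by (simp add: pw_poly_intros algebra_simps)
qed

lemma energy_identity:
  "inner_h ut u + 2 / 3 * b * inner_h vt v
    = a * (\<Sum>i=1..N. T i * jump N X u i) - a * D u (proj_h (\<lambda>x. 3 * (u x)\<^sup>2))
      - b * (\<Sum>i=1..N. Theta N X k u v v i)"
proof -
  \<comment> \<open>The equation for \<open>q\<close> is tested with \<open>p\<close> and that for
    \<open>p\<close> with \<open>q\<close>. As \<open>D q q = 0\<close>, only the nonlinear term
    survives, and it returns to \<open>D u\<close> through the projection.\<close>
  have "D u p = inner_h p q"
    using q_eq [OF dg(3)] by (simp add: mesh_inner_commute)
  also have "\<dots> = inner_h (\<lambda>x. 3 * (u x)\<^sup>2) q"
    using p_eq [OF dg(2)] weak_deriv_self [OF pw(2)] by (simp add: mesh_inner_cmult_left)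
  also have "\<dots> = inner_h q (proj_h (\<lambda>x. 3 * (u x)\<^sup>2))"
    using pw dg by (simp add: mesh_inner_proj pw_poly_intros mesh_inner_commute [of _ _ _ q])
  also have "\<dots> = D u (proj_h (\<lambda>x. 3 * (u x)\<^sup>2))"
    using pw by (intro q_eq proj_in_dg_space pw_poly_intros)
  finally have up: "D u p = D u (proj_h (\<lambda>x. 3 * (u x)\<^sup>2))" .
  \<comment> \<open>In turn, \<open>D r v = - D v r\<close>, which is minus the inner product of
    \<open>w\<close> and \<open>r\<close>, that is \<open>- D w w = 0\<close>.\<close>
  have rv: "D r v = 0"
    using weak_deriv_antisym [OF pw(5,6)] w_eq [OF dg(5)] r_eq [OF dg(4)] weak_deriv_self [OF pw(4)]
    by (simp add: mesh_inner_commute [of _ _ w])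
  have "inner_h (\<lambda>x. u x * w x) v = inner_h w (\<lambda>x. u x * v x)"
    by (simp add: mesh_inner_def mult_ac)
  also have "\<dots> = D v (proj_h (\<lambda>x. u x * v x))"
    using pw dg mesh_inner_proj [of "\<lambda>x. u x * v x" w k] w_eq [OF proj_in_dg_space, of "\<lambda>x. u x * v x"]
    by (simp add: pw_poly_intros)
  finally have uwv: "inner_h (\<lambda>x. u x * w x) v = D v (proj_h (\<lambda>x. u x * v x))" .
  \<comment> \<open>The weight 2/3 turns the coefficient 3 of \<open>uw\<close> into 2, so that the
    coupling terms combine to \<open>- b\<close> times the sum of \<open>Theta\<close> at
    \<open>u, v, v\<close>.\<close>
  show ?thesis
    using ut_eq [OF dg(1)] vt_eq [OF dg(6)] sum_Theta [OF dg(1,6,6)]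
    by (simp add: up rv uwv power2_eq_square algebra_simps)
qed

text \<open>The left-hand side is the time derivative of the Hamiltonian after elimination of the
  time derivatives of \<open>q\<close> and \<open>w\<close>.\<close>

lemma hamiltonian_identity:
  "(1 + a) * inner_h ut p + b * inner_h ut (\<lambda>x. (v x)\<^sup>2)
      + 2 * b * (inner_h vt (\<lambda>x. u x * v x) + inner_h vt r)
    = (\<Sum>i=1..N. (a * jump N X p i + b * jump N X (proj_h (\<lambda>x. (v x)\<^sup>2)) i) * (a * T i))
      + (\<Sum>i=1..N. a * jump N X p i * T i)
      + 2 * b * (\<Sum>i=1..N. Theta N X k q w v i) - 2 * b * (\<Sum>i=1..N. Theta N X k r u v i)
      - 2 * b * (\<Sum>i=1..N. Theta N X k u w w i) - b * (\<Sum>i=1..N. Theta N X k p v v i)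
      + 6 * b * (inner_h (\<lambda>x. (u x)\<^sup>2) (proj_h (\<lambda>x. w x * v x))
               - inner_h (\<lambda>x. u x * w x) (proj_h (\<lambda>x. u x * v x)))"
proof -
  define Pvv where "Pvv = proj_h (\<lambda>x. (v x)\<^sup>2)"
  define Puv where "Puv = proj_h (\<lambda>x. u x * v x)"
  \<comment> \<open>The symmetric trilinear form to which all projected products reduce when tested
    within the discrete space.\<close>
  define I3 where "I3 \<phi> \<psi> \<eta> = mesh_integral N X (\<lambda>x. \<phi> x * (\<psi> x * \<eta> x))"
    for \<phi> \<psi> \<eta> :: "real \<Rightarrow> real"
  have Pvv: "Pvv \<in> dg_space N X k" and Puv: "Puv \<in> dg_space N X k"
    unfolding Pvv_def Puv_def using pw by (auto intro!: proj_in_dg_space pw_poly_intros)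
  have proj_I3: "inner_h \<phi> (proj_h (\<lambda>x. \<psi> x * \<eta> x)) = I3 \<phi> \<psi> \<eta>"
    and proj_dg: "proj_h (\<lambda>x. \<psi> x * \<eta> x) \<in> dg_space N X k"
    if "\<phi> \<in> dg_space N X k" "\<psi> \<in> dg_space N X k" "\<eta> \<in> dg_space N X k" for \<phi> \<psi> \<eta>
    using mesh_inner_proj [OF pw_poly_mult [OF that(2,3) [THEN pw_poly_dg_space]] that(1)]
      proj_in_dg_space [OF pw_poly_mult [OF that(2,3) [THEN pw_poly_dg_space]], of k]
    by (simp_all add: I3_def mesh_inner_def)
  have I3_perm: "I3 \<phi> \<psi> \<eta> = I3 \<psi> \<phi> \<eta>" "I3 \<phi> \<psi> \<eta> = I3 \<phi> \<eta> \<psi>" for \<phi> \<psi> \<eta>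
    by (simp_all add: I3_def mult_ac)

  \<comment> \<open>The equations for \<open>q\<close>, \<open>w\<close>, \<open>r\<close>,
    \<open>p\<close> remove \<open>D\<close> with first argument \<open>u\<close>, \<open>v\<close>,
    \<open>w\<close>, \<open>q\<close>. For \<open>r\<close> and \<open>p\<close> there is no such
    equation: \<open>D r Puv\<close> and \<open>D p Pvv\<close> stay and are matched with those from
    \<open>vt\<close> and \<open>ut\<close>.\<close>
  have Du: "D u (proj_h (\<lambda>x. \<psi> x * \<eta> x)) = I3 q \<psi> \<eta>"
    and Dv: "D v (proj_h (\<lambda>x. \<psi> x * \<eta> x)) = I3 w \<psi> \<eta>"
    and Dw: "D w (proj_h (\<lambda>x. \<psi> x * \<eta> x)) = I3 r \<psi> \<eta>"
    and Dq: "D q (proj_h (\<lambda>x. \<psi> x * \<eta> x)) = I3 p \<psi> \<eta> - 3 * inner_h (\<lambda>x. (u x)\<^sup>2) (proj_h (\<lambda>x. \<psi> x * \<eta> x))"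
    if "\<psi> \<in> dg_space N X k" "\<eta> \<in> dg_space N X k" for \<psi> \<eta>
    using q_eq [OF proj_dg [OF dg(1) that]] w_eq [OF proj_dg [OF dg(1) that]]
      r_eq [OF proj_dg [OF dg(1) that]] p_eq [OF proj_dg [OF dg(1) that]]
    by (simp_all add: proj_I3 dg that)
  have Theta1: "(\<Sum>i=1..N. Theta N X k q w v i)
      = I3 p w v - 3 * inner_h (\<lambda>x. (u x)\<^sup>2) (proj_h (\<lambda>x. w x * v x)) + I3 r q v + I3 w q w"
    using sum_Theta [OF dg(2,4,6)] by (simp add: Du Dv Dw Dq dg)
  have Theta2: "(\<Sum>i=1..N. Theta N X k r u v i) = D r Puv + I3 q r v + I3 w r u"
    using sum_Theta [OF dg(5,1,6)] by (simp add: Du Dv Dw Dq dg Puv_def)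
  have Theta3: "(\<Sum>i=1..N. Theta N X k u w w i) = I3 q w w + 2 * I3 r u w"
    using sum_Theta [OF dg(1,4,4)] by (simp add: Du Dv Dw Dq dg)
  have Theta4: "(\<Sum>i=1..N. Theta N X k p v v i) = D p Pvv + 2 * I3 w p v"
    using sum_Theta [OF dg(3,6,6)] by (simp add: Du Dv Dw Dq dg Pvv_def power2_eq_square)

  have utp: "inner_h ut p = - b * D p Pvv + a * (\<Sum>i=1..N. T i * jump N X p i)"
    using ut_eq [OF dg(3)] weak_deriv_self [OF pw(3)] by (simp add: Pvv_def)
  have "inner_h ut (\<lambda>x. (v x)\<^sup>2) = inner_h ut Pvv"
    unfolding Pvv_def using pw dg by (simp add: mesh_inner_proj pw_poly_intros)
  also have "\<dots> = a * D p Pvv + a * (\<Sum>i=1..N. T i * jump N X Pvv i)"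
    using ut_eq [OF Pvv] weak_deriv_self weak_deriv_antisym [OF pw(3), of Pvv] Pvv
    by (simp add: Pvv_def pw_poly_dg_space)
  finally have utvv: "inner_h ut (\<lambda>x. (v x)\<^sup>2) = a * D p Pvv + a * (\<Sum>i=1..N. T i * jump N X Pvv i)" .
  have "inner_h (\<lambda>x. u x * w x) r = I3 r u w"
    by (simp add: mesh_inner_def I3_def mult_ac)
  then have vtr: "inner_h vt r = - 3 * I3 r u w"
    using vt_eq [OF dg(5)] weak_deriv_self [OF pw(5)] by simp
  have "inner_h vt (\<lambda>x. u x * v x) = inner_h vt Puv"
    unfolding Puv_def using pw dg by (simp add: mesh_inner_proj pw_poly_intros)
  then have vtuv: "inner_h vt (\<lambda>x. u x * v x) = - D r Puv - 3 * inner_h (\<lambda>x. u x * w x) Puv"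
    using vt_eq [OF Puv] by simp
  have perms: "I3 p w v = I3 w p v" "I3 r q v = I3 q r v" "I3 w q w = I3 q w w" "I3 w r u = I3 r u w"
    using I3_perm by metis+
  have sums: "(\<Sum>i=1..N. (a * jump N X p i + b * jump N X Pvv i) * (a * T i))
      = a * a * (\<Sum>i=1..N. T i * jump N X p i) + a * b * (\<Sum>i=1..N. T i * jump N X Pvv i)"
    "(\<Sum>i=1..N. a * jump N X p i * T i) = a * (\<Sum>i=1..N. T i * jump N X p i)"
    by (simp_all add: sum_distrib_left sum.distrib algebra_simps)
  \<comment> \<open>In the combination of the \<open>Theta\<close> sums the trilinear terms cancel
    except \<open>- 6 * b * I3 r u w\<close>, which is the contribution of \<open>vtr\<close>; the
    terms with the square of \<open>u\<close> and projected \<open>wv\<close> cancel against the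
    explicit correction.\<close>
  show ?thesis
    unfolding Theta1 Theta2 Theta3 Theta4 utp utvv vtr vtuv perms sums
      Pvv_def [symmetric] Puv_def [symmetric]
    by (simp add: algebra_simps)
qed

end

section \<open>Conservation of mass, energy and Hamiltonian along solutions\<close>

theorem theorem3p2:
  fixes a b xL xR :: real and N k :: nat and X :: "nat \<Rightarrow> real"
    and J :: "real set"
    and u q p w r v :: "real \<Rightarrow> real \<Rightarrow> real"
    and \<tau>pu \<tau>pv :: "real \<Rightarrow> real"
    and f V :: "real \<Rightarrow> real"
  assumes mesh: "is_partition xL xR N X"
    and times: "is_interval J" "interior J \<noteq> {}"
    and in_space: "\<And>t. t \<in> J \<Longrightarrow> {u t, q t, p t, w t, r t, v t} \<subseteq> dg_space N X k"
    and smooth: "time_differentiable N X J u" "time_differentiable N X J q"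
      "time_differentiable N X J w" "time_differentiable N X J v"
    and f_def: "\<And>y. f y = 3 * y^2"
    and V_antiderivative: "\<And>y. (V has_real_derivative f y) (at y)"
    and scheme: "\<And>t. t \<in> J \<Longrightarrow>
      hs_kdv_dg N X k a b (u t) (q t) (p t) (w t) (r t) (v t)
        (time_deriv J u t) (time_deriv J v t)
        (avg N X (u t))
        (avg N X (q t))
        (\<lambda>i. avg N X (p t) i + \<tau>pu t * jump N X (u t) i + \<tau>pv t * jump N X (v t) i)
        (avg N X (v t))
        (avg N X (w t))
        (avg N X (r t))
        (avg N X (proj N X k (\<lambda>x. (v t x)^2)))"
    and constraint1: "\<And>t. t \<in> J \<Longrightarrow>
      (\<Sum>i=1..N.
          a * \<tau>pu t * (jump N X (u t) i)^2
        + a * \<tau>pv t * jump N X (u t) i * jump N X (v t) i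
        - a * jump N X (\<lambda>x. V (u t x)) i
        + a * jump N X (u t) i * avg N X (proj N X k (\<lambda>x. f (u t x))) i
        - b * Theta N X k (u t) (v t) (v t) i) = 0"
    and constraint2: "\<And>t. t \<in> J \<Longrightarrow>
      (\<Sum>i=1..N.
          (a * jump N X (p t) i + b * jump N X (proj N X k (\<lambda>x. (v t x)^2)) i)
            * (a * \<tau>pu t * jump N X (u t) i + a * \<tau>pv t * jump N X (v t) i)
        + a * jump N X (p t) i * (\<tau>pu t * jump N X (u t) i + \<tau>pv t * jump N X (v t) i)
        + 2 * b * Theta N X k (q t) (w t) (v t) i
        - 2 * b * Theta N X k (r t) (u t) (v t) i
        - 2 * b * Theta N X k (u t) (w t) (w t) i
        - b * Theta N X k (p t) (v t) (v t) i)
      + 6 * b * (mesh_inner N X (\<lambda>x. (u t x)^2) (proj N X k (\<lambda>x. w t x * v t x))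
               - mesh_inner N X (\<lambda>x. u t x * w t x) (proj N X k (\<lambda>x. u t x * v t x))) = 0"
  shows "\<forall>t\<in>J.
      ((\<lambda>s. mesh_integral N X (\<lambda>x. u s x)) has_real_derivative 0) (at t within J) \<and>
      ((\<lambda>s. mesh_integral N X (\<lambda>x. (u s x)^2 + 2 / 3 * b * (v s x)^2))
        has_real_derivative 0) (at t within J) \<and>
      ((\<lambda>s. mesh_integral N X (\<lambda>x.
          (1 + a) * ((u s x)^3 - 1 / 2 * (q s x)^2) + b * (u s x * (v s x)^2 - (w s x)^2)))
        has_real_derivative 0) (at t within J)"
proof
  fix t assume t: "t \<in> J"
  interpret mesh N X
    using mesh by unfold_locales (auto simp: is_partition_def)
  \<comment> \<open>An interval with nonempty interior has no isolated points, so derivatives within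
    \<open>J\<close> are unique even at its endpoints.\<close>
  have nontrivial: "at t within J \<noteq> bot"
  proof -
    have "J \<noteq> {x}" for x
      using times(2) by auto
    then have "t islimpt J"
      using times(1) t by (intro connected_imp_perfect is_interval_connected) auto
    then show ?thesis
      by (simp add: trivial_limit_within)
  qed
  have in_dg: "u s \<in> dg_space N X k" "q s \<in> dg_space N X k" "p s \<in> dg_space N X k"
    "w s \<in> dg_space N X k" "r s \<in> dg_space N X k" "v s \<in> dg_space N X k" if "s \<in> J" for s
    using in_space [OF that] by auto
  have curve: "dg_curve N X k J t \<phi> (time_deriv J \<phi> t)"
    if "time_differentiable N X J \<phi>" "\<And>s. s \<in> J \<Longrightarrow> \<phi> s \<in> dg_space N X k" for \<phi>
  proof unfold_locales
    fix i x assume "i \<in> {1..N}" "x \<in> elem X i"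
    then have "(\<lambda>s. \<phi> s x) differentiable (at t within J)"
      using that(1) t unfolding time_differentiable_def by blast
    then show "((\<lambda>s. \<phi> s x) has_real_derivative time_deriv J \<phi> t x) (at t within J)"
      by (simp add: time_deriv_def has_real_derivative_iff_has_vector_derivative flip: vector_derivative_works)
  qed (use that t nontrivial in auto)
  interpret u: dg_curve N X k J t u "time_deriv J u t" by (rule curve [OF smooth(1) in_dg(1)])
  interpret q: dg_curve N X k J t q "time_deriv J q t" by (rule curve [OF smooth(2) in_dg(2)])
  interpret w: dg_curve N X k J t w "time_deriv J w t" by (rule curve [OF smooth(3) in_dg(4)])
  interpret v: dg_curve N X k J t v "time_deriv J v t" by (rule curve [OF smooth(4) in_dg(6)])
  define ut qt wt vt where "ut = time_deriv J u t" and "qt = time_deriv J q t"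
    and "wt = time_deriv J w t" and "vt = time_deriv J v t"
  note defs = ut_def qt_def wt_def vt_def
  note dg_t [folded defs] = u.deriv_in_dg_space q.deriv_in_dg_space w.deriv_in_dg_space v.deriv_in_dg_space
  note DERIV [folded defs] = u.F_deriv q.F_deriv w.F_deriv v.F_deriv
  define T where "T i = \<tau>pu t * jump N X (u t) i + \<tau>pv t * jump N X (v t) i" for i
  have weak_q: "mesh_inner N X (q s) \<alpha> = weak_deriv N X (u s) \<alpha>"
    and weak_w: "mesh_inner N X (w s) \<alpha> = weak_deriv N X (v s) \<alpha>"
    if "s \<in> J" "\<alpha> \<in> dg_space N X k" for s \<alpha>
    using scheme [OF that(1)] that in_dg [OF that(1)]
    by (auto simp: hs_kdv_dg_def weak_deriv_eq_bdry pw_poly_dg_space algebra_simps)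
  interpret hs_kdv_weak N X k a b "u t" "q t" "p t" "w t" "r t" "v t" ut vt T
    using scheme [OF t] in_dg [OF t] dg_t
    by unfold_locales (simp_all add: T_def jump_0 defs add.assoc)
  \<comment> \<open>The equations for \<open>q\<close> and \<open>w\<close> hold at all times with
    the same test function; both sides are differentiated at \<open>t\<close>.\<close>
  have weak_qt: "mesh_inner N X qt \<alpha> = weak_deriv N X ut \<alpha>"
    and weak_wt: "mesh_inner N X wt \<alpha> = weak_deriv N X vt \<alpha>"
    if \<alpha>: "\<alpha> \<in> dg_space N X k" for \<alpha>
    unfolding defs
    using has_real_derivative_unique_within [OF has_real_derivative_cong_within
        [OF q.DERIV_mesh_inner [OF \<alpha>] weak_q [OF _ \<alpha>] t] u.DERIV_weak_deriv [OF \<alpha>] nontrivial]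
      has_real_derivative_unique_within [OF has_real_derivative_cong_within
        [OF w.DERIV_mesh_inner [OF \<alpha>] weak_w [OF _ \<alpha>] t] v.DERIV_weak_deriv [OF \<alpha>] nontrivial]
    by auto
  have pw_t: "pw_poly N X ut" "pw_poly N X qt" "pw_poly N X wt" "pw_poly N X vt"
    using dg_t by (simp_all add: pw_poly_dg_space)

  have mass: "((\<lambda>s. mesh_integral N X (\<lambda>x. u s x)) has_real_derivative 0) (at t within J)"
  proof -
    have one: "(\<lambda>x. 1) \<in> dg_space N X k"
      by (rule dg_space_const)
    \<comment> \<open>Testing the equation for \<open>u\<close> with 1 annihilates derivative, jumps
      and penalty.\<close>
    have "weak_deriv N X (\<lambda>x. 1) \<phi> = 0" for \<phi>
      by (simp add: weak_deriv_def mesh_inner_def mesh_integral_def jump_const)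
    then have "mesh_integral N X ut = 0"
      using ut_eq [OF one] by (simp add: mesh_inner_def jump_const)
    with u.DERIV_mesh_integral show ?thesis
      by (simp add: ut_def)
  qed

  have energy: "((\<lambda>s. mesh_integral N X (\<lambda>x. (u s x)^2 + 2 / 3 * b * (v s x)^2))
      has_real_derivative 0) (at t within J)"
  proof -
    define E' where "E' x = 2 * (ut x * u t x) + 4 / 3 * b * (vt x * v t x)" for x
    interpret E: dg_curve N X "k + k" J t "\<lambda>s x. (u s x)^2 + 2 / 3 * b * (v s x)^2" E'
    proof unfold_locales
      show "(\<lambda>x. (u s x)^2 + 2 / 3 * b * (v s x)^2) \<in> dg_space N X (k + k)" if "s \<in> J" for s
        unfolding power2_eq_square using in_dg [OF that]
        by (intro dg_space_add dg_space_cmult dg_space_mult)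
      show "((\<lambda>s. (u s x)^2 + 2 / 3 * b * (v s x)^2) has_real_derivative E' x) (at t within J)"
        if "i \<in> {1..N}" "x \<in> elem X i" for i x
        using DERIV(1,4) [OF that] unfolding E'_def
        by (auto intro!: derivative_eq_intros simp: algebra_simps)
    qed (use t nontrivial in auto)
    \<comment> \<open>The antiderivative \<open>V\<close> is fixed only up to a constant, and
      constants have no jumps.\<close>
    define c where "c = V 0 - 0 ^ 3"
    have "((\<lambda>y. V y - y ^ 3) has_real_derivative 0) (at y)" for y
      using V_antiderivative [of y] by (auto intro!: derivative_eq_intros simp: f_def)
    then have "V y - y ^ 3 = c" for y
      unfolding c_def by (intro DERIV_isconst_all) auto
    then have V: "V y = y ^ 3 + c" for y
      by (simp add: diff_eq_eq add.commute)
    have "(\<Sum>i=1..N. jump N X (\<lambda>x. V (u t x)) i)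
        = inner_h (deriv (u t)) (\<lambda>x. 3 * (u t x)\<^sup>2)"
      unfolding V sum_jump_cube [OF pw(1), symmetric] using pw
      by (intro sum.cong) (simp_all add: jump_add pw_poly_intros jump_const)
    then have "(\<Sum>i=1..N. jump N X (\<lambda>x. V (u t x)) i
          - jump N X (u t) i * avg N X (proj_h (\<lambda>x. 3 * (u t x)\<^sup>2)) i)
        = D (u t) (proj_h (\<lambda>x. 3 * (u t x)\<^sup>2))"
      using pw in_dg [OF t] by (simp add: sum_subtractf weak_deriv_proj pw_poly_intros)
    moreover have "(\<Sum>i=1..N.
          a * \<tau>pu t * (jump N X (u t) i)^2
        + a * \<tau>pv t * jump N X (u t) i * jump N X (v t) i
        - a * jump N X (\<lambda>x. V (u t x)) i
        + a * jump N X (u t) i * avg N X (proj_h (\<lambda>x. f (u t x))) i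
        - b * Theta N X k (u t) (v t) (v t) i)
      = a * (\<Sum>i=1..N. T i * jump N X (u t) i)
        - a * (\<Sum>i=1..N. jump N X (\<lambda>x. V (u t x)) i
            - jump N X (u t) i * avg N X (proj_h (\<lambda>x. 3 * (u t x)\<^sup>2)) i)
        - b * (\<Sum>i=1..N. Theta N X k (u t) (v t) (v t) i)"
      unfolding sum_distrib_left sum_subtractf [symmetric]
      by (intro sum.cong refl) (simp add: T_def f_def power2_eq_square algebra_simps)
    ultimately have zero: "inner_h ut (u t) + 2 / 3 * b * inner_h vt (v t) = 0"
      using constraint1 [OF t] energy_identity by simp
    have "mesh_integral N X E' = 2 * inner_h ut (u t) + 4 / 3 * b * inner_h vt (v t)"
      unfolding E'_def mesh_inner_def using pw pw_t
      by (simp add: mesh_integral_add mesh_integral_cmult pw_poly_intros del: times_divide_eq_left)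
    with zero have "mesh_integral N X E' = 0"
      by (simp add: algebra_simps)
    with E.DERIV_mesh_integral show ?thesis
      by simp
  qed

  have hamiltonian: "((\<lambda>s. mesh_integral N X (\<lambda>x.
      (1 + a) * ((u s x)^3 - 1 / 2 * (q s x)^2) + b * (u s x * (v s x)^2 - (w s x)^2)))
      has_real_derivative 0) (at t within J)"
  proof -
    define H' where "H' x = (1 + a) * (3 * (ut x * (u t x)\<^sup>2) - qt x * q t x)
      + b * (ut x * (v t x)\<^sup>2 + 2 * (vt x * (u t x * v t x)) - 2 * (wt x * w t x))" for x
    \<comment> \<open>The cubic terms need degree \<open>3k\<close>; the quadratic ones are embedded
      there.\<close>
    interpret H: dg_curve N X "k + (k + k)" J t
      "\<lambda>s x. (1 + a) * ((u s x)^3 - 1 / 2 * (q s x)^2) + b * (u s x * (v s x)^2 - (w s x)^2)" H'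
    proof unfold_locales
      show "(\<lambda>x. (1 + a) * ((u s x)^3 - 1 / 2 * (q s x)^2) + b * (u s x * (v s x)^2 - (w s x)^2))
          \<in> dg_space N X (k + (k + k))" if "s \<in> J" for s
        unfolding power2_eq_square power3_eq_cube mult.assoc using in_dg [OF that]
        by (intro dg_space_add dg_space_diff dg_space_cmult dg_space_mult
            dg_space_mono [OF dg_space_mult [of _ N X k _ k], of _ _ "k + (k + k)"]) auto
      show "((\<lambda>s. (1 + a) * ((u s x)^3 - 1 / 2 * (q s x)^2) + b * (u s x * (v s x)^2 - (w s x)^2))
          has_real_derivative H' x) (at t within J)" if "i \<in> {1..N}" "x \<in> elem X i" for i x
        using DERIV [OF that] unfolding H'_def
        by (auto intro!: derivative_eq_intros simp: power2_eq_square algebra_simps)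
    qed (use t nontrivial in auto)
    \<comment> \<open>The differentiated equation is tested with \<open>q\<close>, then, after
      antisymmetry, the equation for \<open>p\<close> with \<open>ut\<close>. The resulting cubic
      term cancels the one from differentiating the cube of \<open>u\<close>.\<close>
    have qt_q: "inner_h qt (q t) = - inner_h ut (p t) + 3 * inner_h ut (\<lambda>x. (u t x)\<^sup>2)"
      using weak_qt [OF in_dg(2) [OF t]] weak_deriv_antisym [OF pw_t(1) pw(2)] p_eq [OF dg_t(1)]
      by (simp add: mesh_inner_commute [of _ _ ut])
    \<comment> \<open>The same argument with the equation for \<open>r\<close> tested with
      \<open>vt\<close>.\<close>
    have wt_w: "inner_h wt (w t) = - inner_h vt (r t)"
      using weak_wt [OF in_dg(4) [OF t]] weak_deriv_antisym [OF pw_t(4) pw(4)] r_eq [OF dg_t(4)]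
      by (simp add: mesh_inner_commute [of _ _ vt])
    have "mesh_integral N X H' = (1 + a) * (3 * inner_h ut (\<lambda>x. (u t x)\<^sup>2) - inner_h qt (q t))
        + b * (inner_h ut (\<lambda>x. (v t x)\<^sup>2) + 2 * inner_h vt (\<lambda>x. u t x * v t x) - 2 * inner_h wt (w t))"
      unfolding H'_def mesh_inner_def using pw pw_t
      by (simp add: mesh_integral_add mesh_integral_diff mesh_integral_cmult pw_poly_intros)
    also have "\<dots> = (1 + a) * inner_h ut (p t) + b * inner_h ut (\<lambda>x. (v t x)\<^sup>2)
        + 2 * b * (inner_h vt (\<lambda>x. u t x * v t x) + inner_h vt (r t))"
      unfolding qt_q wt_w by (simp add: algebra_simps)
    also have "\<dots> = 0"
      unfolding hamiltonian_identity using constraint2 [OF t]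
      by (simp add: sum.distrib sum_subtractf sum_distrib_left T_def distrib_left mult.assoc)
    finally show ?thesis
      using H.DERIV_mesh_integral by simp
  qed

  from mass energy hamiltonian show
    "((\<lambda>s. mesh_integral N X (\<lambda>x. u s x)) has_real_derivative 0) (at t within J) \<and>
      ((\<lambda>s. mesh_integral N X (\<lambda>x. (u s x)^2 + 2 / 3 * b * (v s x)^2))
        has_real_derivative 0) (at t within J) \<and>
      ((\<lambda>s. mesh_integral N X (\<lambda>x.
          (1 + a) * ((u s x)^3 - 1 / 2 * (q s x)^2) + b * (u s x * (v s x)^2 - (w s x)^2)))
        has_real_derivative 0) (at t within J)"
    by blast
qed

end
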